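(* Let $G$ be a locally finite Borel graph, let $f:V(G)\to\mathbb{Z}$ be a bounded Borel function, and let $\phi$ be a Borel $f$-flow on $G$. Assume that $G$ admits a Borel connected toast. Then $G$ has an integral (i.e. $\mathbb{Z}$-valued) Borel $f$-flow $\psi$ such that $|\phi(e)-\psi(e)|<3$ for every edge $e$.
   Context: A Borel graph is a graph $G$ whose vertex set $V(G)$ is a Polish space and whose edge set $E(G)$ is a (symmetric, irreflexive) Borel subset of $V(G)^2$. It is locally finite if every vertex has finitely many neighbors. $N(x)$ is the set of neighbors of $x$, and for a set $K$ of vertices $N(K)=\bigcup_{x\in K}N(x)$. Flow: for $f:V(G)\to\mathbb{Z}$, an $f$-flow is a function $\phi:E(G)\to\mathbb{R}$ (on ordered pairs) with $\phi(x,y)=-\phi(y,x)$ for every edge $(x,y)$ and $\sum_{y\in N(x)}\phi(x,y)=f(x)$ for every $x\in V(G)$. Connected toast: a Borel collection $\mathcal{T}$ of finite connected subsets of $V(G)$ (Borel as a subset of the standard Borel space of finite subsets of $V(G)$; connected means that the induced subgraph is connected) such that (1) $\bigcup_{K\in\mathcal{T}}E(K)=E(G)$, where $E(K)$ is the set of edges with both endpoints in $K$; (2) for every pair of distinct $K,L\in\mathcal{T}$, either $(K\cup N(K))\cap L=\emptyset$, or $K\cup N(K)\subseteq L$, or $L\cup N(L)\subseteq K$; (3) for every $K\in\mathcal{T}$ the induced subgraph on $K\setminus\bigcup\{L\in\mathcal{T}:L\subsetneq K\}$ is connected. *)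

theory Defs
  imports "HOL-Analysis.Analysis"
begin

text \<open>
  Graphs are given by their set of ordered edges; the vertex set is the whole underlying type.
  Thus \<open>E `` {x}\<close> is the set of neighbours of a vertex, \<open>E `` K\<close> is \<open>N(K)\<close>, and
  \<open>E \<inter> K \<times> K\<close> is \<open>E(K)\<close>.
\<close>

definition borel_graph :: "('a::polish_space \<times> 'a) set \<Rightarrow> bool" where
  "borel_graph E \<longleftrightarrow> sym E \<and> irrefl E \<and> E \<in> sets borel"

definition locally_finite_graph :: "('a \<times> 'a) set \<Rightarrow> bool" where
  "locally_finite_graph E \<longleftrightarrow> (\<forall>x. finite (E `` {x}))"

text \<open>
  Flows are functions on all pairs, but only their values on \<open>E\<close> are constrained.
\<close>

definition is_flow :: "('a \<times> 'a) set \<Rightarrow> ('a \<Rightarrow> int) \<Rightarrow> ('a \<times> 'a \<Rightarrow> real) \<Rightarrow> bool" where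
  "is_flow E f \<phi> \<longleftrightarrow>
     (\<forall>(x, y) \<in> E. \<phi> (x, y) = - \<phi> (y, x)) \<and>
     (\<forall>x. (\<Sum>y \<in> E `` {x}. \<phi> (x, y)) = of_int (f x))"

definition borel_flow ::
    "('a::polish_space \<times> 'a) set \<Rightarrow> ('a \<Rightarrow> int) \<Rightarrow> ('a \<times> 'a \<Rightarrow> real) \<Rightarrow> bool" where
  "borel_flow E f \<phi> \<longleftrightarrow> is_flow E f \<phi> \<and> \<phi> \<in> borel_measurable (restrict_space borel E)"

text \<open>
  Connectedness of the induced subgraph on \<open>K\<close>. The empty set counts as connected; allowing
  the empty set as a member of a toast makes no difference.
\<close>

definition connected_in :: "('a \<times> 'a) set \<Rightarrow> 'a set \<Rightarrow> bool" where
  "connected_in E K \<longleftrightarrow> (\<forall>x\<in>K. \<forall>y\<in>K. (x, y) \<in> (E \<inter> K \<times> K)\<^sup>*)"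

text \<open>
  The standard Borel space of finite subsets: the trace on the finite sets of the Effros Borel
  structure, that is, of the Borel sets of the Vietoris topology on compact sets.
\<close>

definition finite_sets_borel :: "'a::polish_space set measure" where
  "finite_sets_borel =
     sigma {K. finite K} {{K. finite K \<and> K \<inter> U \<noteq> {}} | U. open U}"

definition connected_toast :: "('a::polish_space \<times> 'a) set \<Rightarrow> 'a set set \<Rightarrow> bool" where
  "connected_toast E T \<longleftrightarrow>
     (\<forall>K\<in>T. finite K \<and> connected_in E K) \<and>
     (\<Union>K\<in>T. E \<inter> K \<times> K) = E \<and>
     (\<forall>K\<in>T. \<forall>L\<in>T. K \<noteq> L \<longrightarrow>
        (K \<union> E `` K) \<inter> L = {} \<or> K \<union> E `` K \<subseteq> L \<or> L \<union> E `` L \<subseteq> K) \<and>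
     (\<forall>K\<in>T. connected_in E (K - \<Union>{L \<in> T. L \<subset> K}))"

definition borel_connected_toast :: "('a::polish_space \<times> 'a) set \<Rightarrow> 'a set set \<Rightarrow> bool" where
  "borel_connected_toast E T \<longleftrightarrow> T \<in> sets finite_sets_borel \<and> connected_toast E T"

end

theory Submission
  imports Defs
begin

text \<open>
  The rings \<open>K - \<Union>{L \<in> T. L \<subset> K}\<close> of the toast partition the non-isolated vertices into finite
  connected sets, and an edge joins vertices of the same ring or of a ring and its parent ring. For each
  \<open>M \<in> T\<close>, take \<open>\<phi>\<close> on the edges between the ring of \<open>M\<close> and its child rings, and inside each of these
  rings send the resulting boundary values along integral paths to one root. This is a finite flow with
  integral divergences, so cancelling fractional cycles rounds it with error less than 1; hence the
  fractional boundary edges become integral after adding a circulation of size less than 1. An edge inside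
  a ring is changed by only two of these circulations, that of its own ring and that of the parent ring,
  and afterwards each ring is rounded separately, which costs another error less than 1.

  All choices are the least admissible index in a countable family of Borel functions that interpolates
  every integer function on a finite set. The sets \<open>{e. \<psi> e = j}\<close> are then projections of Borel
  sets that partition \<open>E\<close>, so they are Borel by Lusin's separation theorem.
\<close>

section \<open>Projections of Borel sets\<close>

text \<open>Two facts make the divergences integral. For a child \<open>L\<close> of
  \<open>M\<close>, the boundary values on its ring add up to the net flow out of \<open>L\<close>,
  which is the sum of \<open>f\<close> over \<open>L\<close>. The divergences of an antisymmetric
  matrix add up to 0, which settles the root in the ring of \<open>M\<close> itself. Because the
  correction is a circulation on all these rings together, its part inside a child ring exactly
  compensates its part on the boundary edges, so the corrections for different members of
  \<open>T\<close> fit together. The obstacle is descriptive: an edge determines the members of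
  \<open>T\<close> involved, but finding them, and then roots, paths and roundings, calls for a
  Borel choice. Here the finite sets are guessed as enumerations. Being a correct guess and yielding
  the value \<open>j\<close> are Borel conditions, because they reduce to finite quantifiers over
  indices, and every correct guess yields the same value. This independence of the guess is what
  makes the projections for different \<open>j\<close> disjoint.\<close>

lemma borel_separable_UN:
  fixes A B :: "nat \<Rightarrow> 'x::topological_space set"
  assumes "\<And>i j. \<exists>D\<in>sets borel. A i \<subseteq> D \<and> D \<inter> B j = {}"
  shows "\<exists>D\<in>sets borel. (\<Union>i. A i) \<subseteq> D \<and> D \<inter> (\<Union>j. B j) = {}"
proof -
  obtain D where D: "\<And>i j. D i j \<in> sets borel \<and> A i \<subseteq> D i j \<and> D i j \<inter> B j = {}"
    using assms by metis
  show ?thesis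
  proof (intro bexI conjI)
    show "(\<Union>i. \<Inter>j. D i j) \<in> sets borel"
      using D by (intro sets.countable_UN sets.countable_INT) auto
    show "(\<Union>i. A i) \<subseteq> (\<Union>i. \<Inter>j. D i j)" "(\<Union>i. \<Inter>j. D i j) \<inter> (\<Union>j. B j) = {}"
      using D by blast+
  qed
qed

lemma countable_cball_cover:
  fixes S :: "'w::{metric_space, second_countable_topology} set"
  assumes "0 < (e::real)"
  obtains c :: "nat \<Rightarrow> 'w" where "S \<subseteq> (\<Union>i. cball (c i) e)"
proof -
  obtain D :: "'w set" where D: "countable D" "\<And>X. open X \<Longrightarrow> X \<noteq> {} \<Longrightarrow> \<exists>d\<in>D. d \<in> X"
    using countable_dense_exists by blast
  have ne: "D \<noteq> {}" using D(2)[of UNIV] by auto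
  have "w \<in> (\<Union>i. cball (from_nat_into D i) e)" for w
  proof -
    obtain d where d: "d \<in> D" "d \<in> ball w e"
      using D(2)[of "ball w e"] assms by auto
    moreover obtain i where "from_nat_into D i = d"
      using from_nat_into_surj[OF D(1) d(1)] by auto
    ultimately show ?thesis by (auto simp: dist_commute less_imp_le intro!: exI[of _ i])
  qed
  then show ?thesis using that by blast
qed

text \<open>
  If two images are not separated, then some pair of their countably many pieces of small diameter is not
  separated either. Iterating, the pieces shrink to two points with distinct images, which have
  disjoint open neighbourhoods.
\<close>

lemma lusin_separation_closed:
  fixes g h :: "'w::{complete_space, second_countable_topology} \<Rightarrow> 'x::t2_space"
  assumes "closed C" "closed C'" "continuous_on UNIV g" "continuous_on UNIV h"
    and disj: "g ` C \<inter> h ` C' = {}"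
  shows "\<exists>D\<in>sets borel. g ` C \<subseteq> D \<and> D \<inter> h ` C' = {}"
proof (rule ccontr)
  define sep where "sep S S' \<longleftrightarrow> (\<exists>D\<in>sets borel. g ` S \<subseteq> D \<and> D \<inter> h ` S' = {})" for S S'
  assume "\<not> ?thesis"
  then have ns: "\<not> sep C C'" by (simp add: sep_def)
  define P where "P n = (\<lambda>(S, S'). S \<subseteq> C \<and> S' \<subseteq> C' \<and> \<not> sep S S')" for n :: nat
  define Q where "Q n = (\<lambda>(S, S') (R, R'). R \<subseteq> (S :: 'w set) \<and> R' \<subseteq> (S' :: 'w set) \<and>
      (\<exists>c. R \<subseteq> cball c ((1/2)^n)) \<and> (\<exists>c. R' \<subseteq> cball c ((1/2)^n)))" for n
  have step: "\<exists>y. P (Suc n) y \<and> Q n x y" if "P n x" for n x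
  proof -
    obtain S S' where x: "x = (S, S')" by force
    have S: "S \<subseteq> C" "S' \<subseteq> C'" "\<not> sep S S'" using that by (auto simp: P_def x)
    have e: "(0::real) < (1/2)^n" by simp
    obtain c :: "nat \<Rightarrow> 'w" where c: "S \<subseteq> (\<Union>i. cball (c i) ((1/2)^n))"
      by (rule countable_cball_cover[OF e, where S = S])
    obtain c' :: "nat \<Rightarrow> 'w" where c': "S' \<subseteq> (\<Union>i. cball (c' i) ((1/2)^n))"
      by (rule countable_cball_cover[OF e, where S = S'])
    have "\<exists>i j. \<not> sep (S \<inter> cball (c i) ((1/2)^n)) (S' \<inter> cball (c' j) ((1/2)^n))"
    proof (rule ccontr)
      assume "\<not> ?thesis"
      then have "\<exists>D\<in>sets borel. (\<Union>i. g ` (S \<inter> cball (c i) ((1/2)^n))) \<subseteq> D \<and>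
          D \<inter> (\<Union>j. h ` (S' \<inter> cball (c' j) ((1/2)^n))) = {}"
        by (intro borel_separable_UN) (auto simp: sep_def)
      moreover have "(\<Union>i. g ` (S \<inter> cball (c i) ((1/2)^n))) = g ` S"
        "(\<Union>j. h ` (S' \<inter> cball (c' j) ((1/2)^n))) = h ` S'"
        using c c' by blast+
      ultimately show False using S(3) by (simp add: sep_def)
    qed
    then obtain i j where
      "\<not> sep (S \<inter> cball (c i) ((1/2)^n)) (S' \<inter> cball (c' j) ((1/2)^n))" by blast
    then show ?thesis using S
      by (intro exI[of _ "(S \<inter> cball (c i) ((1/2)^n), S' \<inter> cball (c' j) ((1/2)^n))"])
        (auto simp: P_def Q_def x)
  qed
  obtain F where F: "\<And>n. P n (F n)" "\<And>n. Q n (F n) (F (Suc n))"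
  proof -
    have "P 0 (C, C')" using ns by (simp add: P_def)
    then show ?thesis using that dependent_nat_choice[of P Q] step by blast
  qed
  define S S' where "S n = fst (F n)" and "S' n = snd (F n)" for n
  have S: "S n \<subseteq> C" "S' n \<subseteq> C'" "\<not> sep (S n) (S' n)" for n
    using F(1)[of n] by (auto simp: P_def S_def S'_def split: prod.splits)
  have Q: "S (Suc n) \<subseteq> S n" "S' (Suc n) \<subseteq> S' n"
    "\<exists>c. S (Suc n) \<subseteq> cball c ((1/2)^n)" "\<exists>c. S' (Suc n) \<subseteq> cball c ((1/2)^n)" for n
    using F(2)[of n] by (auto simp: Q_def S_def S'_def split: prod.splits)
  \<comment> \<open>The pieces need not be closed, so the limit is only found in the closed set
    \<open>D\<close> around them. What is used later is that every neighbourhood of it contains some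
    whole piece.\<close>
  have lim: "\<exists>l\<in>D. \<forall>U. open U \<longrightarrow> l \<in> U \<longrightarrow> (\<exists>n. R n \<subseteq> U)"
    if R: "\<And>n. R n \<subseteq> D" "\<And>n. R n \<noteq> {}" "\<And>n. R (Suc n) \<subseteq> R n"
      "\<And>n. \<exists>c. R (Suc n) \<subseteq> cball c ((1/2)^n)" and D: "closed D"
    for R :: "nat \<Rightarrow> 'w set" and D
  proof -
    have mono: "R n \<subseteq> R m" if "m \<le> n" for m n
      using that R(3) by (rule lift_Suc_antimono_le[rotated])
    have d: "dist a b \<le> 2 * (1/2)^n" if "a \<in> R (Suc n)" "b \<in> R (Suc n)" for a b n
    proof -
      obtain c where "R (Suc n) \<subseteq> cball c ((1/2)^n)" using R(4) by blast
      then have "dist c a \<le> (1/2)^n" "dist c b \<le> (1/2)^n" using that by auto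
      then show ?thesis using dist_triangle3[of a b c] by linarith
    qed
    have "\<forall>n. \<exists>x. x \<in> R n" using R(2) by auto
    then obtain s where s: "\<And>n. s n \<in> R n" by metis
    have small: "\<exists>n. 2 * (1/2)^n < e" if e: "e > 0" for e :: real
    proof -
      obtain n where "(1/2)^n < e/2" using real_arch_pow_inv[of "e/2" "1/2"] e by auto
      then have "2 * (1/2)^n < e" by linarith
      then show ?thesis ..
    qed
    have "Cauchy s"
    proof (rule metric_CauchyI)
      fix e :: real assume "e > 0"
      then obtain n where n: "2 * (1/2)^n < e" using small by blast
      show "\<exists>M. \<forall>m\<ge>M. \<forall>k\<ge>M. dist (s m) (s k) < e"
      proof (intro exI allI impI)
        fix m k assume "m \<ge> Suc n" "k \<ge> Suc n"
        then have "s m \<in> R (Suc n)" "s k \<in> R (Suc n)" using s mono by blast+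
        then show "dist (s m) (s k) < e" using d n by fastforce
      qed
    qed
    then obtain l where l: "s \<longlonglongrightarrow> l" using Cauchy_convergent convergent_def by blast
    have "l \<in> D" using closed_sequentially[OF D] l s R(1) by blast
    moreover have "\<exists>n. R n \<subseteq> U" if U: "open U" "l \<in> U" for U
    proof -
      obtain e where e: "e > 0" "ball l e \<subseteq> U" using U open_contains_ball by blast
      obtain n where n: "2 * (1/2)^n < e/2" using small[of "e/2"] e by auto
      obtain k where k: "k \<ge> Suc n" "dist (s k) l < e/2"
        using l e(1) unfolding lim_sequentially
        by (metis half_gt_zero le_cases)
      have "R (Suc n) \<subseteq> ball l e"
      proof
        fix a assume "a \<in> R (Suc n)"
        moreover have "s k \<in> R (Suc n)" using s mono k by blast
        ultimately have "dist a (s k) < e/2" using d n by fastforce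
        then show "a \<in> ball l e" using k(2) dist_triangle_half_l[of a "s k" e l]
          by (metis dist_commute mem_ball dist_triangle_half_l)
      qed
      then show ?thesis using e by blast
    qed
    ultimately show ?thesis by blast
  qed
  have ne: "S n \<noteq> {} \<and> S' n \<noteq> {}" for n
  proof (rule ccontr)
    assume a: "\<not> ?thesis"
    \<comment> \<open>An empty piece is separated from anything by the empty set or by the whole
      space.\<close>
    have "sep (S n) (S' n)"
    proof (cases "S n = {}")
      case True then show ?thesis unfolding sep_def by (intro bexI[of _ "{}"]) auto
    next
      case False then show ?thesis using a unfolding sep_def by (intro bexI[of _ UNIV]) auto
    qed
    then show False using S(3) by blast
  qed
  obtain l where l: "l \<in> C" "\<And>U. open U \<Longrightarrow> l \<in> U \<Longrightarrow> \<exists>n. S n \<subseteq> U"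
    using lim[of S C] S(1) ne Q(1,3) assms(1) by blast
  obtain l' where l': "l' \<in> C'" "\<And>U. open U \<Longrightarrow> l' \<in> U \<Longrightarrow> \<exists>n. S' n \<subseteq> U"
    using lim[of S' C'] S(2) ne Q(2,4) assms(2) by blast
  have "g l \<noteq> h l'" using disj l(1) l'(1) by blast
  then obtain U U' where U: "open U" "open U'" "g l \<in> U" "h l' \<in> U'" "U \<inter> U' = {}"
    using hausdorff by metis
  have "open (g -` U)" "open (h -` U')"
    using U(1,2) assms(3,4) by (simp_all add: open_vimage)
  then obtain m n where mn: "S m \<subseteq> g -` U" "S' n \<subseteq> h -` U'"
    using l(2)[of "g -` U"] l'(2)[of "h -` U'"] U by auto
  have "S (max m n) \<subseteq> S m" "S' (max m n) \<subseteq> S' n"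
    using lift_Suc_antimono_le[of S, OF Q(1)] lift_Suc_antimono_le[of S', OF Q(2)] by auto
  then have "g ` S (max m n) \<subseteq> U" "h ` S' (max m n) \<subseteq> U'" using mn by blast+
  then have "sep (S (max m n)) (S' (max m n))"
    unfolding sep_def using U by (intro bexI[of _ U]) auto
  then show False using S(3) by blast
qed

text \<open>The parameter space is \<open>nat \<Rightarrow> real\<close> rather than the Baire
  space: it is complete and second countable, and its coordinates can hold an index or countably
  many further parameters, which keeps countable unions and intersections in the same form.\<close>

definition analytic :: "'x::{complete_space, second_countable_topology} set \<Rightarrow> bool" where
  "analytic A \<longleftrightarrow> (\<exists>C :: ('x \<times> (nat \<Rightarrow> real)) set. closed C \<and> A = fst ` C)"

lemma analytic_closed:
  assumes "closed A" shows "analytic A"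
  unfolding analytic_def using assms
  by (intro exI[of _ "A \<times> UNIV"]) (auto simp: closed_Times)

lemma continuous_on_reindex:
  "continuous_on UNIV (\<lambda>p :: 'x::topological_space \<times> (nat \<Rightarrow> real). (fst p, \<lambda>k. snd p (h k)))"
  by (intro continuous_intros continuous_on_coordinatewise_then_product
      continuous_on_product_then_coordinatewise)

text \<open>Coordinate 0 of the parameter names one of the sets \<open>A n\<close>; the remaining
  coordinates are a parameter for that set.\<close>

lemma analytic_UN:
  fixes A :: "nat \<Rightarrow> 'x::{complete_space, second_countable_topology} set"
  assumes "\<And>n. analytic (A n)"
  shows "analytic (\<Union>n. A n)"
proof -
  obtain C :: "nat \<Rightarrow> ('x \<times> (nat \<Rightarrow> real)) set" where C: "\<And>n. closed (C n)" "\<And>n. A n = fst ` C n"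
    using assms unfolding analytic_def by metis
  define tl :: "'x \<times> (nat \<Rightarrow> real) \<Rightarrow> 'x \<times> (nat \<Rightarrow> real)" where "tl p = (fst p, \<lambda>k. snd p (Suc k))" for p
  have cont0: "continuous_on UNIV (\<lambda>p :: 'x \<times> (nat \<Rightarrow> real). snd p 0)"
    by (intro continuous_intros continuous_on_product_then_coordinatewise)
  \<comment> \<open>For a natural number \<open>snd p 0\<close>, distance less than 1 from
    \<open>n\<close> means equality. Each condition is thus an implication with premise
    \<open>snd p 0 = n\<close>, written in a form that is closed.\<close>
  define D where "D = {p. snd p 0 \<in> \<nat>} \<inter> (\<Inter>n. {p. 1 \<le> \<bar>snd p 0 - real n\<bar>} \<union> tl -` C n)"
  have "closed D" unfolding D_def
  proof (intro closed_Int closed_INT ballI closed_Un)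
    show "closed {p :: 'x \<times> (nat \<Rightarrow> real). snd p 0 \<in> \<nat>}"
      using closed_vimage[OF closed_Nats cont0] by (simp add: vimage_def)
    show "closed {p :: 'x \<times> (nat \<Rightarrow> real). 1 \<le> \<bar>snd p 0 - real n\<bar>}" for n
      by (intro closed_Collect_le continuous_intros cont0)
    show "closed (tl -` C n)" for n
      using C(1) unfolding tl_def by (intro closed_vimage continuous_on_reindex)
  qed
  moreover have "(\<Union>n. A n) = fst ` D"
  proof (intro equalityI subsetI)
    fix x assume "x \<in> (\<Union>n. A n)"
    then obtain n z where z: "(x, z) \<in> C n" using C(2) by auto
    moreover have "n = m" if "\<not> 1 \<le> \<bar>real n - real m\<bar>" for m using that by linarith
    ultimately have "(x, case_nat (real n) z) \<in> D"
      by (auto simp: D_def tl_def simp del: abs_real_def)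
    then show "x \<in> fst ` D" by force
  next
    fix x assume "x \<in> fst ` D"
    then obtain z where z: "(x, z) \<in> D" by auto
    then obtain n where "z 0 = real n" by (auto simp: D_def elim: Nats_cases)
    moreover have "1 \<le> \<bar>z 0 - real n\<bar> \<or> tl (x, z) \<in> C n" using z by (auto simp: D_def)
    ultimately have "tl (x, z) \<in> C n" by simp
    then show "x \<in> (\<Union>n. A n)" using C(2) by (force simp: tl_def)
  qed
  ultimately show ?thesis unfolding analytic_def by blast
qed

text \<open>Parameters for all the sets are stored as the rows of one sequence, so that membership
  in the intersection becomes one closed condition per row.\<close>

lemma analytic_INT:
  fixes A :: "nat \<Rightarrow> 'x::{complete_space, second_countable_topology} set"
  assumes "\<And>n. analytic (A n)"
  shows "analytic (\<Inter>n. A n)"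
proof -
  obtain C :: "nat \<Rightarrow> ('x \<times> (nat \<Rightarrow> real)) set" where C: "\<And>n. closed (C n)" "\<And>n. A n = fst ` C n"
    using assms unfolding analytic_def by metis
  define row :: "nat \<Rightarrow> 'x \<times> (nat \<Rightarrow> real) \<Rightarrow> 'x \<times> (nat \<Rightarrow> real)"
    where "row n p = (fst p, \<lambda>k. snd p (prod_encode (n, k)))" for n p
  have "closed (\<Inter>n. row n -` C n)"
    using C(1) unfolding row_def by (intro closed_INT ballI closed_vimage continuous_on_reindex)
  moreover have "(\<Inter>n. A n) = fst ` (\<Inter>n. row n -` C n)"
  proof (intro equalityI subsetI)
    fix x assume "x \<in> (\<Inter>n. A n)"
    then have "\<forall>n. \<exists>z. (x, z) \<in> C n" using C(2) by fastforce
    then obtain z where z: "\<And>n. (x, z n) \<in> C n" by metis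
    have "(x, \<lambda>m. case prod_decode m of (n, k) \<Rightarrow> z n k) \<in> (\<Inter>n. row n -` C n)"
      using z by (simp add: row_def)
    then show "x \<in> fst ` (\<Inter>n. row n -` C n)" by force
  next
    fix x assume "x \<in> fst ` (\<Inter>n. row n -` C n)"
    then show "x \<in> (\<Inter>n. A n)" using C(2) by (force simp: row_def)
  qed
  ultimately show ?thesis unfolding analytic_def by blast
qed

lemma analytic_open:
  fixes A :: "'x::{complete_space, second_countable_topology} set"
  assumes "open A" shows "analytic A"
proof -
  define c where "c n = {x. 1 / real (Suc n) \<le> infdist x (- A)}" for n
  have cl: "closed (c n)" for n
    unfolding c_def by (intro closed_Collect_le continuous_intros)
  show ?thesis
  proof (cases "- A = {}")
    \<comment> \<open>The value of \<open>infdist\<close> for the empty set is 0 by convention, so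
      all \<open>c n\<close> would be empty here.\<close>
    case True
    then have "A = UNIV" by blast
    then show ?thesis by (simp add: analytic_closed)
  next
    case False
    have "A = (\<Union>n. c n)"
    proof (intro equalityI subsetI)
      fix x assume "x \<in> A"
      then have "infdist x (- A) > 0"
        using in_closed_iff_infdist_zero[of "- A" x] False assms infdist_nonneg[of x "- A"]
        by (auto simp: less_le)
      then obtain n where "inverse (real (Suc n)) < infdist x (- A)" using reals_Archimedean by blast
      then show "x \<in> (\<Union>n. c n)" by (auto simp: c_def inverse_eq_divide intro!: exI[of _ n])
    next
      fix x assume "x \<in> (\<Union>n. c n)"
      then obtain n where "1 / real (Suc n) \<le> infdist x (- A)" by (auto simp: c_def)
      moreover have "1 / real (Suc n) > 0" by simp
      ultimately have "infdist x (- A) \<noteq> 0" by linarith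
      then show "x \<in> A" using infdist_zero[of x "- A"] by blast
    qed
    then show ?thesis using analytic_UN[of c] analytic_closed[OF cl] by simp
  qed
qed

lemma analytic_borel:
  fixes A :: "'x::{complete_space, second_countable_topology} set"
  assumes "A \<in> sets borel" shows "analytic A"
proof -
  have "A \<in> sigma_sets UNIV {S. open S}" using assms by (simp add: borel_def)
  \<comment> \<open>Analytic sets are not closed under complements, so the induction carries both
    halves.\<close>
  then have "analytic A \<and> analytic (- A)"
  proof induction
    case (Basic a)
    then show ?case by (auto intro: analytic_open analytic_closed)
  next
    case Empty
    then show ?case by (auto intro: analytic_closed)
  next
    case (Compl a)
    then show ?case by (simp add: Compl_eq_Diff_UNIV[symmetric])
  next
    case (Union a)
    then show ?case by (auto simp: Compl_UN intro!: analytic_UN analytic_INT)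
  qed
  then show ?thesis ..
qed

text \<open>A Borel set is itself the projection of a closed set, so its projection is a continuous
  image of a closed set, to which the separation of such images applies.\<close>

lemma borel_separation_projections:
  fixes B B' :: "('x::{complete_space, second_countable_topology} \<times> 'y::{complete_space, second_countable_topology}) set"
  assumes B: "B \<in> sets borel" "B' \<in> sets borel" and disj: "fst ` B \<inter> fst ` B' = {}"
  shows "\<exists>D\<in>sets borel. fst ` B \<subseteq> D \<and> D \<inter> fst ` B' = {}"
proof -
  obtain C C' :: "(('x \<times> 'y) \<times> (nat \<Rightarrow> real)) set" where
    C: "closed C" "B = fst ` C" "closed C'" "B' = fst ` C'"
    using analytic_borel[OF B(1)] analytic_borel[OF B(2)] unfolding analytic_def by metis
  have "\<exists>D\<in>sets borel. (\<lambda>p. fst (fst p)) ` C \<subseteq> D \<and> D \<inter> (\<lambda>p. fst (fst p)) ` C' = {}"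
    using C disj by (intro lusin_separation_closed continuous_intros) (simp_all add: image_image)
  then show ?thesis by (simp add: C image_image)
qed

text \<open>Each \<open>A j\<close> can be separated from every other \<open>A k\<close> by a Borel
  set. There are only countably many \<open>k\<close>, so the intersection of these separating sets
  is Borel, and its trace on the union is exactly \<open>A j\<close>. In this way no measurable
  selection of second coordinates is required.\<close>

lemma borel_partition_projections:
  fixes A :: "int \<Rightarrow> 'x::{complete_space, second_countable_topology} set" and B :: "int \<Rightarrow> nat \<Rightarrow> ('x \<times> 'y::{complete_space, second_countable_topology}) set"
  assumes B: "\<And>j i. B j i \<in> sets borel" and A: "\<And>j. A j = (\<Union>i. fst ` B j i)"
    and disj: "\<And>j k. j \<noteq> k \<Longrightarrow> A j \<inter> A k = {}" and borel: "(\<Union>j. A j) \<in> sets borel"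
  shows "A j \<in> sets borel"
proof -
  have "\<exists>D\<in>sets borel. A j \<subseteq> D \<and> D \<inter> A k = {}" if "k \<noteq> j" for k
    unfolding A
  proof (intro borel_separable_UN borel_separation_projections B)
    fix i i'
    have "fst ` B j i \<subseteq> A j" "fst ` B k i' \<subseteq> A k" unfolding A by blast+
    then show "fst ` B j i \<inter> fst ` B k i' = {}" using disj[of j k] that by blast
  qed
  then obtain D where D: "\<And>k. k \<noteq> j \<Longrightarrow> D k \<in> sets borel \<and> A j \<subseteq> D k \<and> D k \<inter> A k = {}"
    by metis
  have "A j = (\<Union>j. A j) \<inter> (\<Inter>k. if k = j then UNIV else D k)" (is "_ = ?R")
  proof (intro equalityI subsetI)
    fix x assume "x \<in> A j"
    then show "x \<in> ?R" using D by (auto split: if_splits)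
  next
    fix x assume x: "x \<in> ?R"
    then obtain k where "x \<in> A k" by blast
    moreover have "x \<in> D k" if "k \<noteq> j" using x that by (auto split: if_splits)
    ultimately show "x \<in> A j" using D by (cases "k = j") blast+
  qed
  moreover have "?R \<in> sets borel"
    using D borel by (intro sets.Int sets.countable_INT') auto
  ultimately show ?thesis by simp
qed

text \<open>The functions are integer combinations of indicators of basic open sets, coded by lists,
  hence countably many. For a finite \<open>S\<close>, each point gets a basic neighbourhood that
  meets \<open>S\<close> only in that point, so on \<open>S\<close> the indicators do not
  interfere.\<close>

lemma interpolating_borel_functions:
  "\<exists>F :: nat \<Rightarrow> 'b::{second_countable_topology, t2_space} \<Rightarrow> int.
     (\<forall>m. F m \<in> borel \<rightarrow>\<^sub>M count_space UNIV) \<and>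
     (\<forall>S g. finite S \<longrightarrow> (\<exists>m. \<forall>x\<in>S. F m x = g x))"
proof -
  obtain U :: "'b set set" where U: "countable U" "topological_basis U"
    using ex_countable_basis by blast
  have "U \<noteq> {}" using U(2) by (metis empty_iff iso_tuple_UNIV_I open_UNIV topological_basisE)
  then have rU: "range (from_nat_into U) = U" using U(1) by (rule range_from_nat_into)
  define V where "V = from_nat_into U"
  define H :: "(nat \<times> int) list \<Rightarrow> 'b \<Rightarrow> int"
    where "H l x = (\<Sum>(i, k)\<leftarrow>l. if x \<in> V i then k else 0)" for l x
  have "open (V i)" for i unfolding V_def using U(2) rU topological_basis_open by blast
  then have [measurable]: "V i \<in> sets borel" for i by auto
  have meas: "H l \<in> borel \<rightarrow>\<^sub>M count_space UNIV" for l
  proof (induction l)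
    case Nil
    then show ?case by (simp add: H_def)
  next
    case (Cons a l)
    obtain i k where a: "a = (i, k)" by force
    have "H (a # l) = (\<lambda>x. (if x \<in> V i then k else 0) + H l x)" by (auto simp: H_def a)
    moreover note [measurable] = Cons
    ultimately show ?case by simp
  qed
  have interp: "\<exists>l. \<forall>x\<in>S. H l x = g x" if S: "finite S" for S and g :: "'b \<Rightarrow> int"
  proof -
    have "\<exists>i. x \<in> V i \<and> V i \<inter> S \<subseteq> {x}" for x
    proof -
      have "open (- (S - {x}))" using S by (intro open_Compl finite_imp_closed) auto
      then obtain u where "u \<in> U" "x \<in> u" "u \<subseteq> - (S - {x})"
        using topological_basisE[OF U(2), of "- (S - {x})" x] by blast
      moreover obtain i where "u = V i" using rU \<open>u \<in> U\<close> by (auto simp: V_def)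
      ultimately show ?thesis by blast
    qed
    then obtain i where i: "\<And>x. x \<in> V (i x)" "\<And>x. V (i x) \<inter> S \<subseteq> {x}" by metis
    obtain xs where xs: "set xs = S" "distinct xs" using finite_distinct_list[OF S] by blast
    have "H (map (\<lambda>x. (i x, g x)) xs) y = g y" if "y \<in> S" for y
    proof -
      have "H (map (\<lambda>x. (i x, g x)) xs) y = (\<Sum>x\<leftarrow>xs. if y \<in> V (i x) then g x else 0)"
        by (simp add: H_def comp_def)
      also have "\<dots> = (\<Sum>x\<in>S. if y \<in> V (i x) then g x else 0)"
        using xs by (simp add: sum_list_distinct_conv_sum_set)
      also have "\<dots> = (\<Sum>x\<in>S. if x = y then g x else 0)"
        using i \<open>y \<in> S\<close> by (intro sum.cong refl if_cong) auto
      finally show ?thesis using that S by simp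
    qed
    then show ?thesis by blast
  qed
  show ?thesis
  proof (intro exI[of _ "\<lambda>m. H (from_nat m)"] conjI allI impI)
    show "H (from_nat m) \<in> borel \<rightarrow>\<^sub>M count_space UNIV" for m by (rule meas)
    show "\<exists>m. \<forall>x\<in>S. H (from_nat m) x = g x" if "finite S" for S g
      using interp[OF that, of g] by (metis from_nat_to_nat)
  qed
qed

section \<open>Rounding antisymmetric matrices\<close>

lemma sum_antisym_zero:
  fixes g :: "'a \<Rightarrow> 'a \<Rightarrow> real"
  assumes "\<And>a b. a \<in> W \<Longrightarrow> b \<in> W \<Longrightarrow> g a b = - g b a"
  shows "(\<Sum>a\<in>W. \<Sum>b\<in>W. g a b) = 0"
proof -
  have "(\<Sum>a\<in>W. \<Sum>b\<in>W. g a b) = (\<Sum>a\<in>W. \<Sum>b\<in>W. - g b a)"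
    by (intro sum.cong refl) (use assms in blast)
  also have "\<dots> = - (\<Sum>a\<in>W. \<Sum>b\<in>W. g b a)" by (simp add: sum_negf)
  also have "(\<Sum>a\<in>W. \<Sum>b\<in>W. g b a) = (\<Sum>a\<in>W. \<Sum>b\<in>W. g a b)" by (rule sum.swap)
  finally show ?thesis by simp
qed

text \<open>In a finite graph without dead ends, a walk that never turns back must revisit a vertex.
  A shortest return is a cycle, and the unit flow around it is a nonzero circulation.\<close>

lemma nonbacktracking_circulation:
  fixes F :: "('a \<times> 'a) set"
  assumes W: "finite W" "F \<subseteq> W \<times> W" and F: "F \<noteq> {}" "irrefl F"
    and next_edge: "\<And>a b. (a, b) \<in> F \<Longrightarrow> \<exists>c. (b, c) \<in> F \<and> c \<noteq> a"
    and sym: "sym F"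
  shows "\<exists>g :: 'a \<Rightarrow> 'a \<Rightarrow> real. (\<forall>a b. g a b = - g b a) \<and> (\<forall>a b. g a b \<noteq> 0 \<longrightarrow> (a, b) \<in> F) \<and>
    (\<forall>a. (\<Sum>b\<in>W. g a b) = 0) \<and> (\<exists>a b. g a b \<noteq> 0)"
proof -
  have "\<exists>p. \<forall>n. p n \<in> F \<and> (fst (p (Suc n)) = snd (p n) \<and> snd (p (Suc n)) \<noteq> fst (p n))"
  proof (rule dependent_nat_choice)
    show "\<exists>x. x \<in> F" using F by auto
    show "\<exists>y. y \<in> F \<and> fst y = snd x \<and> snd y \<noteq> fst x" if "x \<in> F" for x :: "'a \<times> 'a" and n :: nat
      using next_edge[of "fst x" "snd x"] that by auto
  qed
  then obtain p where p: "\<And>n. p n \<in> F" "\<And>n. fst (p (Suc n)) = snd (p n)"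
    "\<And>n. snd (p (Suc n)) \<noteq> fst (p n)" by blast
  define w where "w n = fst (p n)" for n
  have w: "(w n, w (Suc n)) \<in> F" "w (Suc (Suc n)) \<noteq> w n" for n
    using p(1)[of n] p(2)[of n] p(3)[of n] p(2)[of "Suc n"]
    by (simp_all add: w_def)
  have wW: "w n \<in> W" for n using w W by blast
  have "\<not> inj w" using W(1) wW by (meson finite_subset infinite_UNIV_nat finite_imageD image_subsetI)
  then obtain i0 j0 where "i0 < j0" "w i0 = w j0"
    unfolding inj_def by (metis nat_neq_iff)
  then have ex: "\<exists>d i. 0 < d \<and> w i = w (i + d)" by (metis less_imp_add_positive)
  \<comment> \<open>Minimal over all starting points \<open>i\<close>, not just for one of them;
    this makes the vertices of the window injective.\<close>
  define d where "d = (LEAST d. \<exists>i. 0 < d \<and> w i = w (i + d))"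
  obtain i where i: "0 < d" "w i = w (i + d)" using LeastI_ex[OF ex] unfolding d_def by blast
  have least: "d \<le> d'" if "0 < d'" "w k = w (k + d')" for d' k
    unfolding d_def using that by (intro Least_le) blast
  have inj: "t = t'" if "t \<in> {i..<i+d}" "t' \<in> {i..<i+d}" "w t = w t'" for t t'
  proof (rule ccontr)
    assume "t \<noteq> t'"
    then consider "t < t'" | "t' < t" by linarith
    then show False
    proof cases
      case 1 then show False using least[of "t' - t" t] that by auto
    next
      case 2 then show False using least[of "t - t'" t'] that by auto
    qed
  qed
  \<comment> \<open>Length 1 would be a loop, and length 2 would be turning back.\<close>
  have d3: "d \<ge> 3"
  proof -
    have "d \<noteq> 1" using i(2) w(1)[of i] F(2) by (auto simp: irrefl_def)
    moreover have "d \<noteq> 2" using i(2) w(2)[of i] by auto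
    ultimately show ?thesis using i(1) by linarith
  qed
  define g :: "'a \<Rightarrow> 'a \<Rightarrow> real" where "g a b = (\<Sum>t\<in>{i..<i+d}.
     of_bool (w t = a \<and> w (Suc t) = b) - of_bool (w t = b \<and> w (Suc t) = a))" for a b
  show ?thesis
  proof (intro exI[of _ g] conjI allI impI)
    show "g a b = - g b a" for a b by (simp add: g_def sum_negf[symmetric])
    show "(a, b) \<in> F" if "g a b \<noteq> 0" for a b
    proof -
      obtain t where "of_bool (w t = a \<and> w (Suc t) = b) - of_bool (w t = b \<and> w (Suc t) = a) \<noteq> (0::real)"
        using \<open>g a b \<noteq> 0\<close> unfolding g_def by (meson sum.neutral)
      then have "(w t = a \<and> w (Suc t) = b) \<or> (w t = b \<and> w (Suc t) = a)" by (auto split: if_splits)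
      then show ?thesis using w(1)[of t] sym by (auto dest: symD)
    qed
    show "(\<Sum>b\<in>W. g a b) = 0" for a
    proof -
      have "(\<Sum>b\<in>W. g a b) = (\<Sum>t\<in>{i..<i+d}. \<Sum>b\<in>W.
        of_bool (w t = a \<and> w (Suc t) = b) - of_bool (w t = b \<and> w (Suc t) = a))"
        unfolding g_def by (rule sum.swap)
      also have "\<dots> = (\<Sum>t\<in>{i..<i+d}. of_bool (w t = a) - of_bool (w (Suc t) = a))"
      proof (rule sum.cong[OF refl])
        fix t
        have "(\<Sum>b\<in>W. (of_bool (w t = a \<and> w (Suc t) = b) :: real)) =
            (\<Sum>b\<in>W. if b = w (Suc t) then of_bool (w t = a) else 0)"
          "(\<Sum>b\<in>W. (of_bool (w t = b \<and> w (Suc t) = a) :: real)) =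
            (\<Sum>b\<in>W. if b = w t then of_bool (w (Suc t) = a) else 0)"
          by (intro sum.cong; auto)+
        then show "(\<Sum>b\<in>W. of_bool (w t = a \<and> w (Suc t) = b) - of_bool (w t = b \<and> w (Suc t) = a))
          = (of_bool (w t = a) - of_bool (w (Suc t) = a) :: real)"
          using W(1) wW by (simp add: sum_subtractf)
      qed
      also have "\<dots> = of_bool (w i = a) - of_bool (w (i + d) = a)"
        using sum_Suc_diff'[of i "i + d" "\<lambda>t. - (of_bool (w t = a) :: real)"] by simp
      finally show ?thesis using i(2) by simp
    qed
    have "g (w i) (w (Suc i)) = (\<Sum>t\<in>{i..<i+d}. if t = i then 1 else 0)"
      unfolding g_def
    proof (rule sum.cong[OF refl])
      fix t assume t: "t \<in> {i..<i+d}"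
      \<comment> \<open>No step of the cycle undoes its first edge: by injectivity it would have to
        be the step at \<open>Suc i\<close>, which would turn back. Hence nothing cancels and
        \<open>g\<close> has value 1 on the first edge.\<close>
      have "\<not> (w t = w (Suc i) \<and> w (Suc t) = w i)"
      proof
        assume "w t = w (Suc i) \<and> w (Suc t) = w i"
        moreover have "t = Suc i" using inj[of t "Suc i"] t d3 calculation by auto
        ultimately show False using w(2)[of i] by simp
      qed
      moreover have "w t = w i \<longleftrightarrow> t = i" using inj[of t i] t i(1) by auto
      ultimately show "of_bool (w t = w i \<and> w (Suc t) = w (Suc i)) -
          of_bool (w t = w (Suc i) \<and> w (Suc t) = w i) = (if t = i then 1 else 0 :: real)"
        by auto
    qed
    also have "\<dots> = 1" using i(1) by simp
    finally show "\<exists>a b. g a b \<noteq> 0" by (metis zero_neq_one)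
  qed
qed

text \<open>The nonintegral entries form a graph, and integral row sums exclude vertices of degree
  1, so it carries a circulation along which fractional parts can be shifted. The bounds by floor
  and ceiling are what survives the induction: an error bound of 1 at each step would add
  up.\<close>

lemma antisym_matrix_rounding_aux:
  fixes y :: "'a \<Rightarrow> 'a \<Rightarrow> real"
  assumes W: "finite W"
    and "\<And>a b. a \<in> W \<Longrightarrow> b \<in> W \<Longrightarrow> y a b = - y b a"
    and "\<And>a. a \<in> W \<Longrightarrow> (\<Sum>b\<in>W. y a b) \<in> \<int>"
  shows "\<exists>x. (\<forall>a\<in>W. \<forall>b\<in>W. x a b = - x b a \<and> of_int \<lfloor>y a b\<rfloor> \<le> (of_int (x a b) :: real) \<and> of_int (x a b) \<le> (of_int \<lceil>y a b\<rceil> :: real)) \<and>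
    (\<forall>a\<in>W. (\<Sum>b\<in>W. of_int (x a b)) = (\<Sum>b\<in>W. y a b))"
  using assms(2,3)
proof (induction "card {(a, b) \<in> W \<times> W. y a b \<notin> \<int>}" arbitrary: y rule: less_induct)
  case less
  define F where "F = {(a, b) \<in> W \<times> W. y a b \<notin> \<int>}"
  have finF: "finite F" using W by (auto simp: F_def intro: finite_subset[of _ "W \<times> W"])
  show ?case
  proof (cases "F = {}")
    case True
    then have int: "of_int \<lfloor>y a b\<rfloor> = y a b" if "a \<in> W" "b \<in> W" for a b
      using that by (auto simp: F_def)
    have anti: "\<lfloor>y a b\<rfloor> = - \<lfloor>y b a\<rfloor>" if "a \<in> W" "b \<in> W" for a b
      using int[OF that] int[OF that(2,1)] less.prems(1)[OF that]
      by (metis of_int_eq_iff of_int_minus)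
    show ?thesis
    proof (intro exI[of _ "\<lambda>a b. \<lfloor>y a b\<rfloor>"] conjI ballI)
      show "\<lfloor>y a b\<rfloor> = - \<lfloor>y b a\<rfloor>" if "a \<in> W" "b \<in> W" for a b using anti that by blast
      show "of_int \<lfloor>y a b\<rfloor> \<le> (of_int \<lfloor>y a b\<rfloor> :: real)" for a b by simp
      show "of_int \<lfloor>y a b\<rfloor> \<le> (of_int \<lceil>y a b\<rceil> :: real)" for a b by linarith
      show "(\<Sum>b\<in>W. of_int \<lfloor>y a b\<rfloor>) = (\<Sum>b\<in>W. y a b)" if "a \<in> W" for a
        using int that by (intro sum.cong refl) blast
    qed
  next
    case False
    have symF: "sym F"
    proof (rule symI)
      fix a b assume "(a, b) \<in> F"
      then have ab: "a \<in> W" "b \<in> W" "y a b \<notin> \<int>" by (auto simp: F_def)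
      then have "y b a \<notin> \<int>" using less.prems(1)[of a b] minus_in_Ints_iff[of "y b a"] by metis
      then show "(b, a) \<in> F" using ab by (simp add: F_def)
    qed
    have irrF: "irrefl F"
    proof -
      have "y a a = 0" if "a \<in> W" for a using less.prems(1)[OF that that] by simp
      then show ?thesis by (auto simp: F_def irrefl_def)
    qed
    \<comment> \<open>If \<open>y b a\<close> were the only nonintegral entry in row
      \<open>b\<close>, the integral row sum would make it integral too.\<close>
    have nxt: "\<exists>c. (b, c) \<in> F \<and> c \<noteq> a" if "(a, b) \<in> F" for a b
    proof (rule ccontr)
      assume no: "\<not> ?thesis"
      have ab: "a \<in> W" "b \<in> W" "y b a \<notin> \<int>" using symD[OF symF that] by (auto simp: F_def)
      have "(\<Sum>c\<in>W. y b c) = y b a + (\<Sum>c\<in>W - {a}. y b c)" using W ab by (simp add: sum.remove)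
      moreover have "(\<Sum>c\<in>W - {a}. y b c) \<in> \<int>"
        using no ab by (intro Ints_sum) (auto simp: F_def)
      ultimately have "y b a \<in> \<int>" using less.prems(2)[OF ab(2)]
        by (metis Ints_diff add_diff_cancel_right')
      then show False using ab by simp
    qed
    have FW: "F \<subseteq> W \<times> W" by (auto simp: F_def)
    obtain g :: "'a \<Rightarrow> 'a \<Rightarrow> real" where g: "\<And>a b. g a b = - g b a" "\<And>a b. g a b \<noteq> 0 \<Longrightarrow> (a, b) \<in> F"
      "\<And>a. (\<Sum>b\<in>W. g a b) = 0" "\<exists>a b. g a b \<noteq> 0"
      using nonbacktracking_circulation[OF W FW False irrF nxt symF] by blast
    \<comment> \<open>The entries that increase are enough: those that decrease are their mirror
      images, and negation exchanges floor and ceiling.\<close>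
    define P where "P = {(a, b). g a b > 0}"
    have PF: "P \<subseteq> F" using g(2) by (auto simp: P_def)
    then have finP: "finite P" using finF finite_subset by blast
    have neP: "P \<noteq> {}"
    proof -
      obtain a b where "g a b \<noteq> 0" using g(4) by blast
      then have "g a b > 0 \<or> g b a > 0" using g(1)[of a b] by linarith
      then show ?thesis by (auto simp: P_def)
    qed
    \<comment> \<open>The multiple of \<open>g\<close> at which the entry reaches its ceiling.
      Taking the least one keeps all entries within bounds and makes the entry attaining the minimum
      integral.\<close>
    define r where "r = (\<lambda>(a, b). (of_int \<lceil>y a b\<rceil> - y a b) / g a b)"
    define s where "s = Min (r ` P)"
    obtain a0 b0 where ab0: "(a0, b0) \<in> P" "s = r (a0, b0)"
    proof -
      have "s \<in> r ` P" using Min_in[of "r ` P"] finP neP by (simp add: s_def)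
      then show ?thesis using that by auto
    qed
    have s_le: "s \<le> r e" if "e \<in> P" for e using that finP by (auto simp: s_def)
    have s0: "s \<ge> 0" using ab0 by (auto simp: r_def P_def)
    define z where "z a b = y a b + s * g a b" for a b
    have z_antisym: "z a b = - z b a" if "a \<in> W" "b \<in> W" for a b
      using less.prems(1)[OF that] g(1)[of a b] by (simp add: z_def)
    have z_sum: "(\<Sum>b\<in>W. z a b) = (\<Sum>b\<in>W. y a b)" for a
      using g(3)[of a] by (simp add: z_def sum.distrib sum_distrib_left[symmetric])
    have up: "y a b \<le> z a b \<and> z a b \<le> of_int \<lceil>y a b\<rceil>" if "(a, b) \<in> P" for a b
      using s_le[OF that] s0 that by (auto simp: z_def r_def P_def field_simps)
    have bounds: "of_int \<lfloor>y a b\<rfloor> \<le> z a b \<and> z a b \<le> of_int \<lceil>y a b\<rceil>" if ab: "a \<in> W" "b \<in> W" for a b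
    proof -
      consider "g a b = 0" | "(a, b) \<in> P" | "(b, a) \<in> P" using g(1)[of a b] by (fastforce simp: P_def)
      then show ?thesis
      proof cases
        case 1 then show ?thesis by (simp add: z_def)
      next
        case 2 then show ?thesis using up[OF 2] by linarith
      next
        case 3
        have eq: "y a b = - y b a" "z a b = - z b a"
          using less.prems(1)[OF ab] z_antisym[OF ab] by blast+
        have "\<lfloor>y a b\<rfloor> = - \<lceil>y b a\<rceil>" by (simp only: eq(1) floor_minus)
        then show ?thesis using up[OF 3] eq le_of_int_ceiling[of "y a b"] by linarith
      qed
    qed
    have card: "card {(a, b) \<in> W \<times> W. z a b \<notin> \<int>} < card {(a, b) \<in> W \<times> W. y a b \<notin> \<int>}"
    proof (rule psubset_card_mono)
      show "finite {(a, b) \<in> W \<times> W. y a b \<notin> \<int>}" using finF by (simp add: F_def)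
      have "z a b = y a b" if "(a, b) \<notin> F" for a b using g(2)[of a b] that by (auto simp: z_def)
      then have "{(a, b) \<in> W \<times> W. z a b \<notin> \<int>} \<subseteq> F" by (force simp: F_def)
      moreover have "(a0, b0) \<in> F" using ab0 PF by blast
      moreover have "z a0 b0 = of_int \<lceil>y a0 b0\<rceil>" using ab0 by (auto simp: z_def r_def P_def)
      ultimately show "{(a, b) \<in> W \<times> W. z a b \<notin> \<int>} \<subset> {(a, b) \<in> W \<times> W. y a b \<notin> \<int>}"
        unfolding F_def[symmetric] by force
    qed
    have int: "(\<Sum>b\<in>W. z a b) \<in> \<int>" if "a \<in> W" for a using less.prems(2)[OF that] z_sum by simp
    obtain x where x:
      "\<forall>a\<in>W. \<forall>b\<in>W. x a b = - x b a \<and> of_int \<lfloor>z a b\<rfloor> \<le> (of_int (x a b) :: real) \<and> of_int (x a b) \<le> (of_int \<lceil>z a b\<rceil> :: real)"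
      "\<forall>a\<in>W. (\<Sum>b\<in>W. of_int (x a b)) = (\<Sum>b\<in>W. z a b)"
      using less.hyps[OF card z_antisym int] by blast
    show ?thesis
    proof (intro exI[of _ x] conjI ballI)
      fix a b assume ab: "a \<in> W" "b \<in> W"
      show "x a b = - x b a" using x ab by blast
      have "\<lfloor>y a b\<rfloor> \<le> \<lfloor>z a b\<rfloor>" "\<lceil>z a b\<rceil> \<le> \<lceil>y a b\<rceil>" using bounds[OF ab]
        by (simp_all add: le_floor_iff ceiling_le_iff)
      then show "of_int \<lfloor>y a b\<rfloor> \<le> (of_int (x a b) :: real)" "of_int (x a b) \<le> (of_int \<lceil>y a b\<rceil> :: real)"
        using x(1) ab by fastforce+
    next
      show "(\<Sum>b\<in>W. of_int (x a b)) = (\<Sum>b\<in>W. y a b)" if "a \<in> W" for a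
        using x(2) that z_sum by simp
    qed
  qed
qed

lemma antisym_matrix_rounding:
  fixes y :: "'a \<Rightarrow> 'a \<Rightarrow> real"
  assumes "finite W"
    and "\<And>a b. a \<in> W \<Longrightarrow> b \<in> W \<Longrightarrow> y a b = - y b a"
    and "\<And>a. a \<in> W \<Longrightarrow> (\<Sum>b\<in>W. y a b) \<in> \<int>"
  obtains x :: "'a \<Rightarrow> 'a \<Rightarrow> int"
  where "\<And>a b. a \<in> W \<Longrightarrow> b \<in> W \<Longrightarrow> x a b = - x b a"
    "\<And>a b. a \<in> W \<Longrightarrow> b \<in> W \<Longrightarrow> \<bar>x a b - y a b\<bar> < 1"
    "\<And>a. a \<in> W \<Longrightarrow> (\<Sum>b\<in>W. of_int (x a b)) = (\<Sum>b\<in>W. y a b)"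
proof -
  obtain x :: "'a \<Rightarrow> 'a \<Rightarrow> int" where x: "\<forall>a\<in>W. \<forall>b\<in>W. x a b = - x b a \<and> of_int \<lfloor>y a b\<rfloor> \<le> (of_int (x a b) :: real) \<and> of_int (x a b) \<le> (of_int \<lceil>y a b\<rceil> :: real)"
    "\<forall>a\<in>W. (\<Sum>b\<in>W. of_int (x a b)) = (\<Sum>b\<in>W. y a b)"
    using antisym_matrix_rounding_aux[OF assms] by blast
  have "\<bar>x a b - y a b\<bar> < 1" if "a \<in> W" "b \<in> W" for a b
  proof -
    have "of_int \<lfloor>y a b\<rfloor> \<le> (of_int (x a b) :: real)" "of_int (x a b) \<le> (of_int \<lceil>y a b\<rceil> :: real)"
      using x that by blast+
    then show ?thesis using floor_correct[of "y a b"] ceiling_correct[of "y a b"] by linarith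
  qed
  then show ?thesis using that x by blast
qed

text \<open>The unit flows along the steps of a walk telescope. Edges may be used repeatedly, with
  values of any size, because only integrality matters later.\<close>

lemma unit_path_flow:
  assumes "(r, x) \<in> (D \<inter> R \<times> R)\<^sup>*" "sym D" "finite W" "R \<subseteq> W"
  shows "\<exists>p :: 'a \<Rightarrow> 'a \<Rightarrow> int. (\<forall>s t. p s t = - p t s) \<and> (\<forall>s t. p s t \<noteq> 0 \<longrightarrow> (s, t) \<in> D \<inter> R \<times> R) \<and>
    (\<forall>z. (\<Sum>t\<in>W. p z t) = of_bool (z = r) - of_bool (z = x))"
  using assms(1)
proof (induction rule: rtrancl_induct)
  case base
  show ?case by (intro exI[of _ "\<lambda>_ _. 0"]) auto
next
  case (step a b)
  then obtain p :: "'a \<Rightarrow> 'a \<Rightarrow> int" where p: "\<And>s t. p s t = - p t s"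
    "\<And>s t. p s t \<noteq> 0 \<Longrightarrow> (s, t) \<in> D \<inter> R \<times> R"
    "\<And>z. (\<Sum>t\<in>W. p z t) = of_bool (z = r) - of_bool (z = a)" by blast
  have ab: "a \<in> W" "b \<in> W" "(b, a) \<in> D \<inter> R \<times> R" using step(2) assms symD[OF assms(2)] by auto
  define q :: "'a \<Rightarrow> 'a \<Rightarrow> int" where
    "q s t = of_bool (s = a \<and> t = b) - of_bool (s = b \<and> t = a)" for s t
  have "(\<Sum>t\<in>W. q z t) = of_bool (z = a) - of_bool (z = b)" for z
  proof -
    have "(\<Sum>t\<in>W. (of_bool (z = a \<and> t = b) :: int)) = (\<Sum>t\<in>W. if t = b then of_bool (z = a) else 0)"
      "(\<Sum>t\<in>W. (of_bool (z = b \<and> t = a) :: int)) = (\<Sum>t\<in>W. if t = a then of_bool (z = b) else 0)"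
      by (intro sum.cong; auto)+
    then show ?thesis using ab assms(3) by (simp add: q_def sum_subtractf)
  qed
  then have sum: "(\<Sum>t\<in>W. p z t + q z t) = of_bool (z = r) - of_bool (z = b)" for z
    by (simp add: sum.distrib p(3))
  have anti: "p s t + q s t = - (p t s + q t s)" for s t
  proof -
    have "q s t = - q t s"
      unfolding q_def by (simp only: conj_commute[of "t = a"] conj_commute[of "t = b"] minus_diff_eq)
    then show ?thesis by (subst p(1)) (simp only: minus_add_distrib)
  qed
  have supp: "(s, t) \<in> D \<inter> R \<times> R" if nz: "p s t + q s t \<noteq> 0" for s t
  proof (cases "q s t = 0")
    case True
    then show ?thesis using p(2)[of s t] nz by simp
  next
    case False
    then have "(s, t) = (a, b) \<or> (s, t) = (b, a)" by (auto simp: q_def)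
    then show ?thesis using step(2) ab(3) by blast
  qed
  show ?case
    by (intro exI[of _ "\<lambda>s t. p s t + q s t"] conjI allI impI anti sum; rule supp)
qed

section \<open>Toasts\<close>

text \<open>Here \<phi> is extended by 0 off \<open>E\<close>, so a sum over neighbours can be taken
  over any finite set containing them. \<open>F\<close> provides candidates for integral flows on
  finite sets and \<open>G\<close> candidates for systems of paths; the first coordinate of a triple
  is the vertex to which the path belongs.\<close>

locale toast_flow =
  fixes E :: "('a::polish_space \<times> 'a) set" and T :: "'a set set"
    and f :: "'a \<Rightarrow> int" and \<phi> :: "'a \<times> 'a \<Rightarrow> real"
    and F :: "nat \<Rightarrow> 'a \<times> 'a \<Rightarrow> int" and G :: "nat \<Rightarrow> 'a \<times> 'a \<times> 'a \<Rightarrow> int"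
  assumes symE: "sym E" and locfin: "locally_finite_graph E"
    and toast: "connected_toast E T"
    and \<phi>_antisym: "\<And>x y. \<phi> (x, y) = - \<phi> (y, x)"
    and \<phi>_supp: "\<And>e. e \<notin> E \<Longrightarrow> \<phi> e = 0"
    and \<phi>_flow: "\<And>x. (\<Sum>y\<in>E `` {x}. \<phi> (x, y)) = of_int (f x)"
    and F_interp: "\<And>S g. finite S \<Longrightarrow> \<exists>m. \<forall>x\<in>S. F m x = g x"
    and G_interp: "\<And>S g. finite S \<Longrightarrow> \<exists>m. \<forall>x\<in>S. G m x = g x"
begin

section \<open>Cells, rings and collars\<close>

definition ring :: "'a set \<Rightarrow> 'a set" where
  "ring K = K - \<Union>{L \<in> T. L \<subset> K}"

text \<open>The least member containing \<open>x\<close>; it is \<open>UNIV\<close> if no member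
  contains \<open>x\<close>.\<close>

definition cell :: "'a \<Rightarrow> 'a set" where
  "cell x = \<Inter>{K \<in> T. x \<in> K}"

text \<open>The ring of \<open>K\<close> together with the rings of its children.\<close>

definition collar :: "'a set \<Rightarrow> 'a set" where
  "collar K = {x \<in> K. \<forall>L\<in>T. \<forall>L'\<in>T. L \<subset> K \<and> L' \<subset> K \<and> x \<in> L \<and> x \<in> L' \<longrightarrow> L = L'}"

lemma toast_finite: "K \<in> T \<Longrightarrow> finite K"
  using toast by (auto simp: connected_toast_def)

lemma toast_edge:
  assumes "K \<in> T" "L \<in> T" "K \<noteq> L" "x \<in> K" "y \<in> L" "x = y \<or> (x, y) \<in> E"
  shows "K \<union> E `` K \<subseteq> L \<or> L \<union> E `` L \<subseteq> K"
proof -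
  have "y \<in> (K \<union> E `` K) \<inter> L" using assms by auto
  then have "(K \<union> E `` K) \<inter> L \<noteq> {}" by blast
  then show ?thesis using toast assms(1-3) unfolding connected_toast_def by meson
qed

lemma toast_nested:
  assumes "K \<in> T" "L \<in> T" "K \<subset> L" "x \<in> K" "(x, y) \<in> E"
  shows "y \<in> L"
  using toast_edge[of K L x x] assms by blast

lemma covered:
  assumes "(x, y) \<in> E"
  obtains K where "K \<in> T" "x \<in> K" "y \<in> K"
proof -
  have "(x, y) \<in> (\<Union>K\<in>T. E \<inter> K \<times> K)"
    using toast assms unfolding connected_toast_def by simp
  then show ?thesis using that by blast
qed

text \<open>Members through a common vertex are nested, so one of least cardinality is contained in
  all the others.\<close>

lemma cell:
  assumes "K \<in> T" "x \<in> K"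
  shows "cell x \<in> T" "x \<in> cell x" "cell x \<subseteq> K"
proof -
  obtain K' where K': "K' \<in> T" "x \<in> K'" "\<And>L. L \<in> T \<Longrightarrow> x \<in> L \<Longrightarrow> card K' \<le> card L"
    using ex_has_least_nat[of "\<lambda>K. K \<in> T \<and> x \<in> K" K card] assms by blast
  have "K' \<subseteq> L" if L: "L \<in> T" "x \<in> L" for L
  proof (cases "K' = L")
    case False
    then have "K' \<subseteq> L \<or> L \<subseteq> K'" using toast_edge[of K' L x x] K' L by blast
    then show ?thesis using K'(3)[OF L] card_seteq[OF toast_finite[OF K'(1)]] by blast
  qed simp
  then have "cell x = K'" using K' by (auto simp: cell_def)
  then show "cell x \<in> T" "x \<in> cell x" "cell x \<subseteq> K" using K' \<open>\<And>L. \<lbrakk>L \<in> T; x \<in> L\<rbrakk> \<Longrightarrow> K' \<subseteq> L\<close> assms by auto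
qed

lemma cell_edge:
  assumes "(x, y) \<in> E"
  shows "cell x \<in> T" "x \<in> cell x" "cell y \<in> T" "y \<in> cell y"
    "cell x \<noteq> cell y \<Longrightarrow> cell x \<subset> cell y \<or> cell y \<subset> cell x"
proof -
  obtain K where K: "K \<in> T" "x \<in> K" "y \<in> K" using covered[OF assms] by blast
  show x: "cell x \<in> T" "x \<in> cell x" "cell y \<in> T" "y \<in> cell y" using cell K by blast+
  show "cell x \<subset> cell y \<or> cell y \<subset> cell x" if "cell x \<noteq> cell y"
    using toast_edge[OF x(1,3) that x(2,4)] assms that by blast
qed

lemma ring_iff: "K \<in> T \<Longrightarrow> x \<in> ring K \<longleftrightarrow> x \<in> K \<and> cell x = K"
  using cell[of _ x] unfolding ring_def by blast

text \<open>Rephrased with cells, the collar condition says that no member lies strictly between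
  \<open>cell x\<close> and \<open>K\<close>. The defining form only compares members inside
  \<open>K\<close>, which is what the measurability proof can handle.\<close>

lemma collar_iff:
  "K \<in> T \<Longrightarrow> x \<in> collar K \<longleftrightarrow> x \<in> K \<and> (\<forall>L\<in>T. L \<subset> K \<and> x \<in> L \<longrightarrow> L = cell x)"
proof
  assume x: "x \<in> collar K"
  have "L = cell x" if L: "L \<in> T" "L \<subset> K" "x \<in> L" for L
  proof -
    have "cell x \<subset> K" using cell(3)[OF L(1,3)] L(2) by blast
    then show ?thesis using x L cell(1,2)[OF L(1,3)] unfolding collar_def by blast
  qed
  then show "x \<in> K \<and> (\<forall>L\<in>T. L \<subset> K \<and> x \<in> L \<longrightarrow> L = cell x)"
    using x by (simp add: collar_def)
next
  assume "x \<in> K \<and> (\<forall>L\<in>T. L \<subset> K \<and> x \<in> L \<longrightarrow> L = cell x)"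
  then show "x \<in> collar K" unfolding collar_def by auto
qed

lemma collarI:
  "K \<in> T \<Longrightarrow> x \<in> K \<Longrightarrow> (\<And>L. L \<in> T \<Longrightarrow> L \<subset> K \<Longrightarrow> x \<in> L \<Longrightarrow> L = cell x) \<Longrightarrow> x \<in> collar K"
  by (subst collar_iff) blast+

lemma collarD:
  "K \<in> T \<Longrightarrow> x \<in> collar K \<Longrightarrow> L \<in> T \<Longrightarrow> L \<subset> K \<Longrightarrow> x \<in> L \<Longrightarrow> L = cell x"
  by (subst (asm) collar_iff) blast+

lemma collar_subset: "collar K \<subseteq> K"
  by (auto simp: collar_def)

lemma ring_subset_collar: "ring K \<subseteq> collar K"
  by (auto simp: collar_def ring_def)

lemma finite_collar: "K \<in> T \<Longrightarrow> finite (collar K)"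
  using collar_subset toast_finite finite_subset by blast

lemma finite_ring: "K \<in> T \<Longrightarrow> finite (ring K)"
  using ring_subset_collar finite_collar finite_subset by blast

lemma collar_cell:
  assumes "K \<in> T" "x \<in> collar K" "cell y = cell x" "y \<in> cell x"
  shows "y \<in> collar K"
proof -
  have x: "x \<in> K" using assms(2) collar_subset by blast
  have "y \<in> K" using cell[OF assms(1) x] assms(4) by blast
  moreover have "L = cell y" if "L \<in> T" "L \<subset> K" "y \<in> L" for L
  proof -
    have "x \<in> L" using cell[OF \<open>L \<in> T\<close> \<open>y \<in> L\<close>] cell(2)[OF assms(1) x] assms(3) by auto
    then show ?thesis using collarD[OF assms(1,2) that(1,2)] assms(3) by simp
  qed
  ultimately show ?thesis using collarI[OF assms(1)] by blast
qed

text \<open>An edge never skips a level: a member strictly between the two cells would absorb the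
  neighbour \<open>y\<close> and contradict the minimality of \<open>cell y\<close>.\<close>

lemma edge_collar:
  assumes "(x, y) \<in> E" "cell x \<subset> cell y"
  shows "x \<in> collar (cell y)" "y \<in> ring (cell y)"
proof -
  note c = cell_edge[OF assms(1)]
  show "y \<in> ring (cell y)" using c by (simp add: ring_iff)
  have "L = cell x" if L: "L \<in> T" "L \<subset> cell y" "x \<in> L" for L
  proof (rule ccontr)
    assume "L \<noteq> cell x"
    then have "cell x \<subset> L" using cell(3)[OF L(1,3)] by blast
    then have "y \<in> L" using toast_nested[OF c(1) L(1) _ c(2) assms(1)] by blast
    then show False using cell(3)[OF L(1)] L(2) by blast
  qed
  moreover have "x \<in> cell y" using c(2) assms(2) by blast
  ultimately show "x \<in> collar (cell y)" by (intro collarI[OF c(3)])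
qed

text \<open>Distinct child rings are not adjacent: the cells of an edge are nested, while the collar
  leaves no room for one proper submember of \<open>M\<close> inside another.\<close>

lemma collar_edge:
  assumes "M \<in> T" "x \<in> collar M" "y \<in> collar M" "(x, y) \<in> E" "cell x \<noteq> cell y"
  shows "cell x = M \<or> cell y = M"
proof (rule ccontr)
  assume no: "\<not> ?thesis"
  note c = cell_edge[OF assms(4)]
  have M: "cell x \<subset> M" "cell y \<subset> M"
    using no assms(1-3) cell(3)[OF assms(1)] collar_subset by blast+
  consider "cell x \<subset> cell y" | "cell y \<subset> cell x" using c(5) assms(5) by blast
  then show False
  proof cases
    case 1
    then have "x \<in> cell y" using c(2) by blast
    then show False using collarD[OF assms(1,2) c(3) M(2)] assms(5) by simp
  next
    case 2
    then have "y \<in> cell x" using c(4) by blast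
    then show False using collarD[OF assms(1,3) c(1) M(1)] assms(5) by simp
  qed
qed

lemma flow_sum:
  assumes "finite A" "E `` {x} \<subseteq> A"
  shows "(\<Sum>t\<in>A. \<phi> (x, t)) = of_int (f x)"
  unfolding \<phi>_flow[symmetric] using assms
  by (intro sum.mono_neutral_right) (auto simp: \<phi>_supp)

section \<open>Boundary values of a collar and their rounding\<close>

definition bd :: "'a set \<Rightarrow> 'a \<Rightarrow> real" where
  "bd M x = (\<Sum>t\<in>collar M. if cell t = cell x then 0 else \<phi> (x, t))"

text \<open>Inside \<open>M\<close>, an edge from a child ring that leaves the child ends in the
  ring of \<open>M\<close>, so the boundary value is everything that \<phi> sends from
  \<open>x\<close> out of its cell within \<open>M\<close>.\<close>

lemma bd_child:
  assumes M: "M \<in> T" and x: "x \<in> collar M" and ne: "cell x \<noteq> M"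
  shows "bd M x = (\<Sum>t\<in>M - cell x. \<phi> (x, t))"
proof -
  have xM: "x \<in> M" using x collar_subset by blast
  have sub: "cell x \<subset> M" using cell(3)[OF M xM] ne by blast
  have "bd M x = (\<Sum>t\<in>{t \<in> collar M. cell t \<noteq> cell x}. \<phi> (x, t))"
    unfolding bd_def using finite_collar[OF M] by (intro sum.mono_neutral_cong_right) auto
  also have "\<dots> = (\<Sum>t\<in>M - cell x. \<phi> (x, t))"
  proof (rule sum.mono_neutral_left)
    show "finite (M - cell x)" using toast_finite[OF M] by blast
    show "{t \<in> collar M. cell t \<noteq> cell x} \<subseteq> M - cell x"
    proof
      fix t assume "t \<in> {t \<in> collar M. cell t \<noteq> cell x}"
      then have t: "t \<in> collar M" "cell t \<noteq> cell x" by auto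
      then have "t \<notin> cell x" using collarD[OF M t(1) cell(1)[OF M xM] sub] by metis
      then show "t \<in> M - cell x" using t(1) collar_subset by blast
    qed
    show "\<forall>t\<in>M - cell x - {t \<in> collar M. cell t \<noteq> cell x}. \<phi> (x, t) = 0"
    proof
      fix t assume t: "t \<in> M - cell x - {t \<in> collar M. cell t \<noteq> cell x}"
      show "\<phi> (x, t) = 0"
      proof (rule ccontr)
        assume "\<phi> (x, t) \<noteq> 0"
        then have e: "(x, t) \<in> E" using \<phi>_supp by blast
        note c = cell_edge[OF e]
        have ne: "cell t \<noteq> cell x" using c(4) t by auto
        have "\<not> cell t \<subset> cell x" using c(4) t by blast
        then have sub: "cell x \<subset> cell t" using c(5) ne by blast
        have "\<not> cell t \<subset> M"
          using collarD[OF M x c(3)] sub c(2) ne by blast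
        then have "cell t = M" using cell(3)[OF M] t by blast
        then have "t \<in> ring M" using M t by (simp add: ring_iff)
        then have "t \<in> collar M" using ring_subset_collar by blast
        then show False using t ne by blast
      qed
    qed
  qed
  finally show ?thesis .
qed

text \<open>A discrete divergence theorem: summing the flow equation over \<open>L\<close>, the
  edges inside \<open>L\<close> cancel by antisymmetry, and only vertices in the ring of
  \<open>L\<close> have neighbours outside \<open>L\<close>. The neighbours of \<open>L\<close> all
  lie in \<open>M\<close>, so summing over \<open>M\<close> loses nothing.\<close>

lemma sum_bd_child:
  assumes M: "M \<in> T" and L: "L \<in> T" "L \<noteq> M" and x: "x \<in> collar M" "cell x = L"
  shows "(\<Sum>z\<in>{z \<in> collar M. cell z = L}. bd M z) = of_int (\<Sum>z\<in>L. f z)"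
proof -
  have xM: "x \<in> M" using x collar_subset by blast
  have LM: "L \<subset> M" using cell(3)[OF M xM] L x by blast
  have fL: "finite L" "finite M" using toast_finite L M by auto
  have "of_int (\<Sum>z\<in>L. f z) = (\<Sum>z\<in>L. \<Sum>t\<in>M. \<phi> (z, t))"
    unfolding of_int_sum using toast_nested[OF L(1) M LM]
    by (intro sum.cong refl flow_sum[OF fL(2), symmetric]) blast
  also have "\<dots> = (\<Sum>z\<in>L. (\<Sum>t\<in>L. \<phi> (z, t)) + (\<Sum>t\<in>M - L. \<phi> (z, t)))"
    using fL LM by (intro sum.cong refl) (metis add.commute psubset_imp_subset sum.subset_diff)
  also have "\<dots> = (\<Sum>z\<in>L. \<Sum>t\<in>M - L. \<phi> (z, t))"
    by (simp add: sum.distrib sum_antisym_zero[OF \<phi>_antisym])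
  also have "\<dots> = (\<Sum>z\<in>{z \<in> collar M. cell z = L}. \<Sum>t\<in>M - L. \<phi> (z, t))"
  proof (rule sum.mono_neutral_right[OF fL(1)])
    show "{z \<in> collar M. cell z = L} \<subseteq> L" using cell(2)[OF M] collar_subset by blast
    show "\<forall>z\<in>L - {z \<in> collar M. cell z = L}. (\<Sum>t\<in>M - L. \<phi> (z, t)) = 0"
    proof (intro ballI sum.neutral)
      fix z t assume z: "z \<in> L - {z \<in> collar M. cell z = L}" and t: "t \<in> M - L"
      have "cell z \<noteq> L" using z collar_cell[OF M x(1), of z] x(2) by blast
      then have "cell z \<subset> L" using cell(3)[OF L(1)] z by blast
      then have "(z, t) \<notin> E" using toast_nested[OF _ L(1), of "cell z" z t] cell[OF L(1), of z] z t by blast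
      then show "\<phi> (z, t) = 0" by (rule \<phi>_supp)
    qed
  qed
  also have "\<dots> = (\<Sum>z\<in>{z \<in> collar M. cell z = L}. bd M z)"
    using bd_child[OF M] L(2) by (intro sum.cong refl) auto
  finally show ?thesis ..
qed

text \<open>
  With \<open>q (x, _, _)\<close> the unit flow from the root of the ring of \<open>x\<close> to \<open>x\<close>, this flow on the
  collar agrees with \<open>\<phi>\<close> between rings and has divergence 0 away from the roots. The predicate
  \<open>good_bdy\<close> never mentions roots and paths, which keeps it visibly Borel in \<open>M\<close>.
\<close>

definition ybal :: "'a set \<Rightarrow> ('a \<times> 'a \<times> 'a \<Rightarrow> int) \<Rightarrow> 'a \<Rightarrow> 'a \<Rightarrow> real" where
  "ybal M q s t = (if cell s = cell t then \<Sum>x\<in>collar M. bd M x * of_int (q (x, s, t)) else \<phi> (s, t))"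

definition good_bdy :: "'a set \<Rightarrow> ('a \<times> 'a \<times> 'a \<Rightarrow> int) \<Rightarrow> ('a \<times> 'a \<Rightarrow> int) \<Rightarrow> bool" where
  "good_bdy M q c \<longleftrightarrow>
     (\<forall>s\<in>collar M. \<forall>t\<in>collar M. ybal M q s t = - ybal M q t s \<and> ((s, t) \<notin> E \<longrightarrow> ybal M q s t = 0) \<and>
        c (s, t) = - c (t, s) \<and> \<bar>of_int (c (s, t)) - ybal M q s t\<bar> < 1) \<and>
     (\<forall>s\<in>collar M. (\<Sum>t\<in>collar M. of_int (c (s, t))) = (\<Sum>t\<in>collar M. ybal M q s t)) \<and>
     (\<forall>x\<in>collar M. \<forall>s\<in>collar M. \<forall>t\<in>collar M. q (x, s, t) \<noteq> 0 \<longrightarrow> cell x = cell s)"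

text \<open>Routing every boundary value to the root of its ring leaves divergence only at roots,
  and there it is integral, so the matrix can be rounded. The interpolating families then realise
  the finitely many values of the paths and of the rounding.\<close>

lemma good_bdy_exists:
  assumes M: "M \<in> T"
  shows "\<exists>m k. good_bdy M (G k) (F m)"
proof -
  define W where "W = collar M"
  have finW: "finite W" using M by (simp add: W_def finite_collar)
  have cW: "cell x \<in> T \<and> x \<in> cell x \<and> x \<in> ring (cell x)" if "x \<in> W" for x
    using that cell[OF M] collar_subset by (fastforce simp: W_def ring_iff)
  \<comment> \<open>An arbitrary root will do, as only existence is claimed here.\<close>
  define r where "r K = (SOME z. z \<in> ring K)" for K
  have r: "r (cell x) \<in> ring (cell x)" if "x \<in> W" for x
    unfolding r_def using cW[OF that] by (metis someI)
  have "\<exists>p :: 'a \<Rightarrow> 'a \<Rightarrow> int. (\<forall>s t. p s t = - p t s) \<and>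
      (\<forall>s t. p s t \<noteq> 0 \<longrightarrow> (s, t) \<in> E \<inter> ring (cell x) \<times> ring (cell x)) \<and>
      (\<forall>z. (\<Sum>t\<in>W. p z t) = of_bool (z = r (cell x)) - of_bool (z = x))" if x: "x \<in> W" for x
  proof (rule unit_path_flow[OF _ symE finW])
    have "connected_in E (ring (cell x))"
      using toast cW[OF x] by (simp add: connected_toast_def ring_def)
    then show "(r (cell x), x) \<in> (E \<inter> ring (cell x) \<times> ring (cell x))\<^sup>*"
      using r[OF x] cW[OF x] by (simp add: connected_in_def)
    show "ring (cell x) \<subseteq> W"
      using collar_cell[OF M] x cW[OF x] by (auto simp: W_def ring_iff)
  qed
  then obtain p :: "'a \<Rightarrow> 'a \<Rightarrow> 'a \<Rightarrow> int" where
    p: "\<And>x s t. x \<in> W \<Longrightarrow> p x s t = - p x t s"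
      "\<And>x s t. x \<in> W \<Longrightarrow> p x s t \<noteq> 0 \<Longrightarrow> (s, t) \<in> E \<inter> ring (cell x) \<times> ring (cell x)"
      "\<And>x z. x \<in> W \<Longrightarrow> (\<Sum>t\<in>W. p x z t) = of_bool (z = r (cell x)) - of_bool (z = x)"
    by metis
  have p_cell: "cell s = cell x \<and> cell t = cell x \<and> (s, t) \<in> E" if "x \<in> W" "p x s t \<noteq> 0" for x s t
    using p(2)[OF that] cW[OF that(1)] by (auto simp: ring_iff)
  obtain k where k: "\<And>x s t. x \<in> W \<Longrightarrow> s \<in> W \<Longrightarrow> t \<in> W \<Longrightarrow> G k (x, s, t) = p x s t"
    using G_interp[of "W \<times> W \<times> W" "\<lambda>(x, s, t). p x s t"] finW by fastforce
  define y where "y = ybal M (G k)"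
  have y: "y s t = (if cell s = cell t then \<Sum>x\<in>W. bd M x * of_int (p x s t) else \<phi> (s, t))"
    if "s \<in> W" "t \<in> W" for s t
    unfolding y_def ybal_def W_def[symmetric] using k that by (auto intro!: sum.cong)
  have y_antisym: "y s t = - y t s" if st: "s \<in> W" "t \<in> W" for s t
  proof (cases "cell s = cell t")
    case True
    have "(\<Sum>x\<in>W. bd M x * of_int (p x s t)) = (\<Sum>x\<in>W. - (bd M x * of_int (p x t s)))"
    proof (rule sum.cong[OF refl])
      fix x assume "x \<in> W"
      show "bd M x * of_int (p x s t) = - (bd M x * of_int (p x t s))"
        by (subst p(1)[OF \<open>x \<in> W\<close>]) simp
    qed
    then show ?thesis using True by (simp add: y[OF st] y[OF st(2,1)] sum_negf)
  next
    case False
    then show ?thesis using \<phi>_antisym[of s t] by (simp add: y[OF st] y[OF st(2,1)])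
  qed
  have y_supp: "y s t = 0" if st: "s \<in> W" "t \<in> W" "(s, t) \<notin> E" for s t
  proof -
    have "p x s t = 0" if "x \<in> W" for x using p_cell[OF that, of s t] st(3) by blast
    then show ?thesis using \<phi>_supp[OF st(3)] by (simp add: y[OF st(1,2)])
  qed
  \<comment> \<open>The path flow for \<open>z\<close> ends at \<open>z\<close> and cancels the
    boundary value there; the same amount reappears at the root.\<close>
  have row: "(\<Sum>t\<in>W. y z t) = (\<Sum>x\<in>W. bd M x * of_bool (z = r (cell x)))" if z: "z \<in> W" for z
  proof -
    have "(\<Sum>t\<in>W. y z t) = (\<Sum>t\<in>W. (if cell t = cell z then 0 else \<phi> (z, t)) +
        (\<Sum>x\<in>W. bd M x * of_int (p x z t)))"
    proof (rule sum.cong[OF refl])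
      fix t assume t: "t \<in> W"
      have "(\<Sum>x\<in>W. bd M x * of_int (p x z t)) = 0" if "cell t \<noteq> cell z"
        using p_cell[of _ z t] that by (intro sum.neutral) fastforce
      then show "y z t = (if cell t = cell z then 0 else \<phi> (z, t)) + (\<Sum>x\<in>W. bd M x * of_int (p x z t))"
        using y[OF z t] by auto
    qed
    also have "\<dots> = bd M z + (\<Sum>t\<in>W. \<Sum>x\<in>W. bd M x * of_int (p x z t))"
      by (simp add: sum.distrib bd_def W_def)
    also have "(\<Sum>t\<in>W. \<Sum>x\<in>W. bd M x * of_int (p x z t)) =
        (\<Sum>x\<in>W. bd M x * of_int (\<Sum>t\<in>W. p x z t))"
      by (subst sum.swap) (simp add: sum_distrib_left)
    also have "\<dots> = (\<Sum>x\<in>W. bd M x * of_bool (z = r (cell x)) - (if x = z then bd M x else 0))"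
      by (intro sum.cong refl) (auto simp: p(3) algebra_simps)
    also have "\<dots> = (\<Sum>x\<in>W. bd M x * of_bool (z = r (cell x))) - bd M z"
      using z finW by (simp add: sum_subtractf)
    finally show ?thesis by simp
  qed
  have int1: "(\<Sum>t\<in>W. y z t) \<in> \<int>" if z: "z \<in> W" "z \<noteq> r M" for z
  proof -
    have rc: "cell x = cell z" if "x \<in> W" "z = r (cell x)" for x
      using r[OF that(1)] that cW[OF that(1)] by (simp add: ring_iff)
    consider "z \<noteq> r (cell z)" | "z = r (cell z)" "cell z \<noteq> M" using z by metis
    then show ?thesis
    proof cases
      case 1
      then have "(\<Sum>x\<in>W. bd M x * of_bool (z = r (cell x))) = 0"
        using rc by (intro sum.neutral) auto
      then show ?thesis using row[OF z(1)] by simp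
    next
      case 2
      have "(\<Sum>x\<in>W. bd M x * of_bool (z = r (cell x))) = (\<Sum>x\<in>{x \<in> collar M. cell x = cell z}. bd M x)"
        using rc 2 finW by (intro sum.mono_neutral_cong_right) (auto simp: W_def)
      also have "\<dots> = of_int (\<Sum>x\<in>cell z. f x)"
        using z cW[OF z(1)] 2 by (intro sum_bd_child[OF M]) (auto simp: W_def)
      finally show ?thesis using row[OF z(1)] by (metis Ints_of_int)
    qed
  qed
  \<comment> \<open>The ring of \<open>M\<close> has no analogue of the divergence argument for its
    children. Its root is the only vertex left, and all divergences add up to 0.\<close>
  have int2: "(\<Sum>t\<in>W. y z t) \<in> \<int>" if z: "z \<in> W" for z
  proof (cases "z = r M")
    case True
    have "(\<Sum>s\<in>W. \<Sum>t\<in>W. y s t) = 0" using sum_antisym_zero[of W y] y_antisym by blast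
    then have "(\<Sum>t\<in>W. y z t) = - (\<Sum>s\<in>W - {z}. \<Sum>t\<in>W. y s t)"
      using sum.remove[OF finW z, of "\<lambda>s. \<Sum>t\<in>W. y s t"] by linarith
    moreover have "(\<Sum>s\<in>W - {z}. \<Sum>t\<in>W. y s t) \<in> \<int>" using int1 True by (intro Ints_sum[of _ "\<lambda>s. \<Sum>t\<in>W. y s t"]) blast
    ultimately show ?thesis by simp
  qed (use int1 z in blast)
  obtain c :: "'a \<Rightarrow> 'a \<Rightarrow> int" where
    c: "\<And>s t. s \<in> W \<Longrightarrow> t \<in> W \<Longrightarrow> c s t = - c t s"
      "\<And>s t. s \<in> W \<Longrightarrow> t \<in> W \<Longrightarrow> \<bar>of_int (c s t) - y s t\<bar> < 1"
      "\<And>s. s \<in> W \<Longrightarrow> (\<Sum>t\<in>W. of_int (c s t)) = (\<Sum>t\<in>W. y s t)"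
    using antisym_matrix_rounding[OF finW y_antisym int2] by blast
  obtain m where m: "\<And>s t. s \<in> W \<Longrightarrow> t \<in> W \<Longrightarrow> F m (s, t) = c s t"
    using F_interp[of "W \<times> W" "\<lambda>(s, t). c s t"] finW by fastforce
  have "good_bdy M (G k) (F m)"
    unfolding good_bdy_def W_def[symmetric] y_def[symmetric]
  proof (intro conjI ballI impI)
    fix s t assume st: "s \<in> W" "t \<in> W"
    show "y s t = - y t s" by (rule y_antisym[OF st])
    show "y s t = 0" if "(s, t) \<notin> E" by (rule y_supp[OF st that])
    show "F m (s, t) = - F m (t, s)" using c(1)[OF st] m st by simp
    show "\<bar>of_int (F m (s, t)) - y s t\<bar> < 1" using c(2)[OF st] m st by simp
    show "cell x = cell s" if "x \<in> W" "G k (x, s, t) \<noteq> 0" for x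
      using p_cell[of x s t] k st that by auto
  next
    fix s assume "s \<in> W"
    then show "(\<Sum>t\<in>W. of_int (F m (s, t))) = (\<Sum>t\<in>W. y s t)"
      using c(3) m by simp
  qed
  then show ?thesis by blast
qed

text \<open>Only the rounded flow is selected. The path system stays existentially quantified, so
  \<open>bdy\<close> depends on \<open>M\<close> alone.\<close>

definition bdy :: "'a set \<Rightarrow> 'a \<times> 'a \<Rightarrow> int" where
  "bdy M = F (LEAST m. \<exists>k. good_bdy M (G k) (F m))"

lemma good_bdy: "M \<in> T \<Longrightarrow> \<exists>k. good_bdy M (G k) (bdy M)"
  unfolding bdy_def using LeastI_ex[OF good_bdy_exists] by blast

text \<open>The circulation is the rounding error. Rounding preserves row sums, and between rings
  the rounded matrix is \<phi> itself. For the last clause: if the boundary values on a ring are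
  integers, so are the entries inside this ring, since only paths of that ring enter them; an
  integer at distance less than 1 from another one equals it.\<close>

lemma circulation:
  assumes M: "M \<in> T"
  shows "\<exists>d :: 'a \<Rightarrow> 'a \<Rightarrow> real.
    (\<forall>s\<in>collar M. \<forall>t\<in>collar M. d s t = - d t s \<and> \<bar>d s t\<bar> < 1 \<and> ((s, t) \<notin> E \<longrightarrow> d s t = 0) \<and>
       (cell s \<noteq> cell t \<longrightarrow> of_int (bdy M (s, t)) = \<phi> (s, t) + d s t)) \<and>
    (\<forall>s\<in>collar M. (\<Sum>t\<in>collar M. d s t) = 0) \<and>
    (\<forall>s\<in>collar M. (\<forall>x\<in>collar M. cell x = cell s \<longrightarrow> bd M x \<in> \<int>) \<longrightarrow>
       (\<forall>t\<in>collar M. cell t = cell s \<longrightarrow> d s t = 0))"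
proof -
  obtain k where k: "good_bdy M (G k) (bdy M)" using good_bdy[OF M] by blast
  define d where "d s t = of_int (bdy M (s, t)) - ybal M (G k) s t" for s t
  note g = k[unfolded good_bdy_def]
  show ?thesis
  proof (intro exI[of _ d] conjI ballI impI)
    fix s t assume st: "s \<in> collar M" "t \<in> collar M"
    have "ybal M (G k) s t = - ybal M (G k) t s" "bdy M (s, t) = - bdy M (t, s)"
      using g st by blast+
    then show "d s t = - d t s" unfolding d_def by linarith
    show lt: "\<bar>d s t\<bar> < 1" unfolding d_def using g st by blast
    show "d s t = 0" if "(s, t) \<notin> E"
    proof -
      have "ybal M (G k) s t = 0" using g st that by blast
      moreover have "\<bar>of_int (bdy M (s, t)) - ybal M (G k) s t\<bar> < 1" using g st by blast
      ultimately show ?thesis by (simp add: d_def)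
    qed
    show "of_int (bdy M (s, t)) = \<phi> (s, t) + d s t" if "cell s \<noteq> cell t"
      using that by (simp add: d_def ybal_def)
    assume int: "\<forall>x\<in>collar M. cell x = cell s \<longrightarrow> bd M x \<in> \<int>" and eq: "cell t = cell s"
    have "bd M x * of_int (G k (x, s, t)) \<in> \<int>" if "x \<in> collar M" for x
    proof (cases "G k (x, s, t) = 0")
      case False
      then have "cell x = cell s" using g st that by blast
      then show ?thesis using int that by auto
    qed simp
    then have "ybal M (G k) s t \<in> \<int>" using eq by (auto simp: ybal_def)
    then obtain i where "ybal M (G k) s t = of_int i" by (auto elim: Ints_cases)
    then show "d s t = 0" using lt by (simp add: d_def flip: of_int_diff)
  next
    fix s assume "s \<in> collar M"
    then have "(\<Sum>t\<in>collar M. of_int (bdy M (s, t))) = (\<Sum>t\<in>collar M. ybal M (G k) s t)"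
      using g by blast
    then show "(\<Sum>t\<in>collar M. d s t) = 0" by (simp add: d_def sum_subtractf)
  qed
qed

lemma bdy_antisym:
  assumes "M \<in> T" "s \<in> collar M" "t \<in> collar M"
  shows "bdy M (s, t) = - bdy M (t, s)"
  using good_bdy[OF assms(1)] assms unfolding good_bdy_def by blast

lemma bdy_supp:
  assumes "M \<in> T" "s \<in> collar M" "t \<in> collar M" "(s, t) \<notin> E"
  shows "bdy M (s, t) = 0"
proof -
  obtain k where g: "good_bdy M (G k) (bdy M)" using good_bdy[OF assms(1)] by blast
  have "ybal M (G k) s t = 0" "\<bar>of_int (bdy M (s, t)) - ybal M (G k) s t\<bar> < 1"
    using g assms unfolding good_bdy_def by blast+
  then show ?thesis by simp
qed


section \<open>Parents and the flow leaving a ring\<close>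

definition parent :: "'a set \<Rightarrow> 'a set \<Rightarrow> bool" where
  "parent K M \<longleftrightarrow> M \<in> T \<and> K \<subset> M \<and> (\<forall>L\<in>T. K \<subset> L \<and> L \<subseteq> M \<longrightarrow> L = M)"

text \<open>In this form the quantifier ranges over members inside \<open>M\<close> only, hence over
  finitely many subsets once \<open>M\<close> is enumerated.\<close>

lemma parent_iff:
  assumes "M \<in> T"
  shows "parent K M \<longleftrightarrow> K \<subset> M \<and> (\<forall>L\<in>T. L \<subset> M \<longrightarrow> \<not> K \<subset> L)"
  unfolding parent_def using assms by (metis psubset_eq)

text \<open>Two members with a common vertex are comparable; the vertex comes from \<open>K\<close>,
  which is why \<open>K\<close> must be nonempty.\<close>

lemma parent_unique:
  assumes "K \<noteq> {}" "parent K M" "parent K M'"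
  shows "M = M'"
proof (rule ccontr)
  assume "M \<noteq> M'"
  obtain x where "x \<in> K" using assms(1) by blast
  then have "M \<subseteq> M' \<or> M' \<subseteq> M"
    using toast_edge[of M M' x x] assms(2,3) \<open>M \<noteq> M'\<close> unfolding parent_def by blast
  then show False using assms(2,3) \<open>M \<noteq> M'\<close> unfolding parent_def by blast
qed

lemma edge_parent:
  assumes "(x, y) \<in> E" "cell x \<subset> cell y"
  shows "parent (cell x) (cell y)"
  unfolding parent_def
proof (intro conjI ballI impI)
  note c = cell_edge[OF assms(1)]
  show "cell y \<in> T" "cell x \<subset> cell y" by fact+
  fix L assume L: "L \<in> T" "cell x \<subset> L \<and> L \<subseteq> cell y"
  then have "y \<in> L" using toast_nested[OF c(1) L(1) _ c(2) assms(1)] by blast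
  then show "L = cell y" using cell(3)[OF L(1)] L(2) by blast
qed

lemma parent_collar:
  assumes "K \<in> T" "parent K M" "x \<in> ring K"
  shows "x \<in> collar M"
proof (rule collarI)
  have x: "x \<in> K" "cell x = K" using assms(1,3) by (auto simp: ring_iff)
  show "M \<in> T" "x \<in> M" using assms(2) x by (auto simp: parent_def)
  fix L assume L: "L \<in> T" "L \<subset> M" "x \<in> L"
  then have "K \<subseteq> L" using cell(3)[OF L(1,3)] x by blast
  then show "L = cell x" using L assms(2) x unfolding parent_def by blast
qed

text \<open>The flow that \<phi> sends from \<open>x\<close> out of \<open>K\<close>, written
  through the flow equation so that no vertex outside \<open>K\<close> and no parent is
  mentioned.\<close>

definition out :: "'a set \<Rightarrow> 'a \<Rightarrow> real" where
  "out K x = of_int (f x) - (\<Sum>t\<in>K. \<phi> (x, t))"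

definition integral_out :: "'a set \<Rightarrow> bool" where
  "integral_out K \<longleftrightarrow> (\<forall>x\<in>ring K. out K x \<in> \<int>)"

definition bdy_out :: "'a set \<Rightarrow> 'a \<Rightarrow> real" where
  "bdy_out M x = (\<Sum>t\<in>ring M. of_int (bdy M (x, t)))"

text \<open>
  It is not clear that the members of \<open>T\<close> with a parent form a Borel set, whereas \<open>integral_out\<close> is a
  Borel condition whose failure forces a parent to exist. When it holds, the circulation coming from the
  parent vanishes on the ring of \<open>K\<close>, so the parent (if any) can be ignored.
\<close>

definition outflow :: "'a set \<Rightarrow> 'a \<Rightarrow> real" where
  "outflow K = (if integral_out K then out K else bdy_out (THE M. parent K M))"

lemma outflow_integral: "integral_out K \<Longrightarrow> outflow K = out K"
  by (simp add: outflow_def)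

lemma outflow_parent:
  assumes "\<not> integral_out K" "parent K M"
  shows "outflow K = bdy_out M"
proof -
  have "K \<noteq> {}" using assms(1) by (auto simp: integral_out_def ring_def)
  then have "(THE M. parent K M) = M"
    using the_equality[of "parent K" M, OF assms(2)] parent_unique[OF _ _ assms(2)] by blast
  then show ?thesis using assms(1) by (simp add: outflow_def)
qed

lemma out_eq_bd:
  assumes "K \<in> T" "parent K M" "x \<in> ring K"
  shows "out K x = bd M x"
proof -
  have M: "M \<in> T" "K \<subset> M" using assms(2) by (auto simp: parent_def)
  have x: "x \<in> K" "cell x = K" using assms(1,3) by (auto simp: ring_iff)
  have fin: "finite M" "finite K" using M assms(1) by (auto simp: toast_finite)
  have "of_int (f x) = (\<Sum>t\<in>M. \<phi> (x, t))"
    using toast_nested[OF assms(1) M(1,2) x(1)] by (intro flow_sum[symmetric] fin) blast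
  also have "\<dots> = (\<Sum>t\<in>M - K. \<phi> (x, t)) + (\<Sum>t\<in>K. \<phi> (x, t))"
    using M(2) fin by (intro sum.subset_diff) auto
  finally show ?thesis
    using bd_child[OF M(1) parent_collar[OF assms]] x(2) M(2) by (simp add: out_def)
qed

text \<open>An edge leaving \<open>K\<close> from its ring would lead to a strictly larger cell, and
  that cell would be a parent.\<close>

lemma no_parent_edge:
  assumes "K \<in> T" "\<nexists>M. parent K M" "x \<in> ring K"
  shows "E `` {x} \<subseteq> K"
proof
  fix t assume "t \<in> E `` {x}"
  then have e: "(x, t) \<in> E" by simp
  have x: "cell x = K" using assms(1,3) by (simp add: ring_iff)
  have "\<not> cell x \<subset> cell t" using edge_parent[OF e] assms(2) x by blast
  then have "cell t \<subseteq> cell x" using cell_edge(5)[OF e] by blast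
  then show "t \<in> K" using cell_edge(4)[OF e] x by blast
qed

lemma no_parent_out:
  assumes "K \<in> T" "\<nexists>M. parent K M" "x \<in> ring K"
  shows "out K x = 0"
  using flow_sum[OF toast_finite[OF assms(1)] no_parent_edge[OF assms]] by (simp add: out_def)

text \<open>\<open>e\<close> is the circulation of the parent, restricted to the ring of
  \<open>K\<close>, or 0 without a parent. It pays for replacing \<open>out\<close> by
  \<open>outflow\<close>. If \<open>out\<close> is integral on the ring, this circulation vanishes
  there, so both branches of \<open>outflow\<close> describe the rounded outgoing flow.\<close>

lemma parent_outflow:
  assumes K: "K \<in> T"
  shows "\<exists>e :: 'a \<Rightarrow> 'a \<Rightarrow> real.
    (\<forall>s\<in>ring K. \<forall>t\<in>ring K. e s t = - e t s \<and> \<bar>e s t\<bar> < 1 \<and> ((s, t) \<notin> E \<longrightarrow> e s t = 0)) \<and>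
    (\<forall>s\<in>ring K. (\<Sum>t\<in>ring K. e s t) = out K s - outflow K s \<and> outflow K s \<in> \<int>) \<and>
    (\<forall>s\<in>ring K. \<forall>M. parent K M \<longrightarrow> outflow K s = bdy_out M s)"
proof (cases "\<exists>M. parent K M")
  case False
  then have "out K s = 0" if "s \<in> ring K" for s using no_parent_out[OF K False that] by blast
  then have "integral_out K" "\<And>s. s \<in> ring K \<Longrightarrow> outflow K s = 0"
    by (auto simp: integral_out_def outflow_def)
  then show ?thesis using False \<open>\<And>s. s \<in> ring K \<Longrightarrow> out K s = 0\<close>
    by (intro exI[of _ "\<lambda>_ _. 0"]) auto
next
  case True
  then obtain M where par: "parent K M" by blast
  then have M: "M \<in> T" "K \<subset> M" by (auto simp: parent_def)
  obtain d :: "'a \<Rightarrow> 'a \<Rightarrow> real" where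
    d: "\<forall>s\<in>collar M. \<forall>t\<in>collar M. d s t = - d t s \<and> \<bar>d s t\<bar> < 1 \<and> ((s, t) \<notin> E \<longrightarrow> d s t = 0) \<and>
       (cell s \<noteq> cell t \<longrightarrow> of_int (bdy M (s, t)) = \<phi> (s, t) + d s t)"
      "\<forall>s\<in>collar M. (\<Sum>t\<in>collar M. d s t) = 0"
      "\<forall>s\<in>collar M. (\<forall>x\<in>collar M. cell x = cell s \<longrightarrow> bd M x \<in> \<int>) \<longrightarrow>
         (\<forall>t\<in>collar M. cell t = cell s \<longrightarrow> d s t = 0)"
    using circulation[OF M(1)] by blast
  have rc: "s \<in> collar M" "cell s = K" if "s \<in> ring K" for s
    using parent_collar[OF K par that] that K by (auto simp: ring_iff)
  have cr: "s \<in> ring K" if "s \<in> collar M" "cell s = K" for s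
    using that cell(2)[OF M(1), of s] collar_subset K by (auto simp: ring_iff)
  \<comment> \<open>All collar edges from \<open>s\<close> that leave the ring of \<open>K\<close>
    end in the ring of \<open>M\<close>, where rounding adds \<open>d\<close> to \<phi>. Divergence
    0 at \<open>s\<close> turns this change into minus the sum over the ring of
    \<open>K\<close>.\<close>
  have bdy_out: "bdy_out M s = bd M s - (\<Sum>t\<in>ring K. d s t)" if s: "s \<in> ring K" for s
  proof -
    note s' = rc[OF s]
    have "bdy_out M s = (\<Sum>t\<in>{t \<in> collar M. cell t \<noteq> K}. of_int (bdy M (s, t)))"
      unfolding bdy_out_def
    proof (rule sum.mono_neutral_left)
      show "finite {t \<in> collar M. cell t \<noteq> K}" using finite_collar[OF M(1)] by simp
      show "ring M \<subseteq> {t \<in> collar M. cell t \<noteq> K}"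
        using ring_subset_collar M by (auto simp: ring_iff)
      show "\<forall>t\<in>{t \<in> collar M. cell t \<noteq> K} - ring M. of_int (bdy M (s, t)) = (0::real)"
      proof
        fix t assume t: "t \<in> {t \<in> collar M. cell t \<noteq> K} - ring M"
        then have "cell t \<noteq> M" using M collar_subset by (auto simp: ring_iff)
        then have "(s, t) \<notin> E" using collar_edge[OF M(1) s'(1), of t] t s'(2) M(2) by auto
        then show "of_int (bdy M (s, t)) = (0::real)" using bdy_supp[OF M(1) s'(1)] t by simp
      qed
    qed
    also have "\<dots> = (\<Sum>t\<in>{t \<in> collar M. cell t \<noteq> K}. \<phi> (s, t) + d s t)"
    proof (rule sum.cong[OF refl])
      fix t assume "t \<in> {t \<in> collar M. cell t \<noteq> K}"
      then have "t \<in> collar M" "cell s \<noteq> cell t" using s'(2) by auto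
      then show "of_int (bdy M (s, t)) = \<phi> (s, t) + d s t" using d(1) s'(1) by blast
    qed
    also have "\<dots> = bd M s + (\<Sum>t\<in>{t \<in> collar M. cell t \<noteq> K}. d s t)"
      unfolding sum.distrib bd_def using finite_collar[OF M(1)] s'(2)
      by (intro arg_cong2[of _ _ _ _ "(+)"] refl sum.mono_neutral_cong_left) auto
    also have "{t \<in> collar M. cell t \<noteq> K} = collar M - ring K"
      using rc cr by blast
    also have "(\<Sum>t\<in>collar M - ring K. d s t) = - (\<Sum>t\<in>ring K. d s t)"
    proof -
      have "(\<Sum>t\<in>collar M. d s t) = (\<Sum>t\<in>collar M - ring K. d s t) + (\<Sum>t\<in>ring K. d s t)"
        using rc finite_collar[OF M(1)] by (intro sum.subset_diff) auto
      then show ?thesis using d(2) s'(1) by simp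
    qed
    finally show ?thesis by simp
  qed
  have outflow: "outflow K s = bdy_out M s" if s: "s \<in> ring K" for s
  proof (cases "integral_out K")
    case True
    have "(\<Sum>t\<in>ring K. d s t) = 0"
    proof (rule sum.neutral, rule ballI)
      fix t assume t: "t \<in> ring K"
      have "\<forall>x\<in>collar M. cell x = cell s \<longrightarrow> bd M x \<in> \<int>"
        using True out_eq_bd[OF K par] cr rc[OF s] unfolding integral_out_def by metis
      then show "d s t = 0" using d(3) rc[OF s] rc[OF t] by metis
    qed
    then show ?thesis using True bdy_out[OF s] out_eq_bd[OF K par s] by (simp add: outflow_def)
  next
    case False
    then show ?thesis by (simp add: outflow_parent[OF _ par])
  qed
  show ?thesis
  proof (intro exI[of _ d] conjI ballI allI impI)
    fix s assume s: "s \<in> ring K"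
    show "(\<Sum>t\<in>ring K. d s t) = out K s - outflow K s"
      using outflow[OF s] bdy_out[OF s] out_eq_bd[OF K par s] by simp
    show "outflow K s \<in> \<int>" unfolding outflow[OF s] bdy_out_def by auto
    show "outflow K s = bdy_out M' s" if "parent K M'" for M'
      using outflow[OF s] parent_unique[OF _ par that] s by (metis ring_def Diff_empty equals0D empty_Diff)
    fix t assume t: "t \<in> ring K"
    show "d s t = - d t s" "\<bar>d s t\<bar> < 1" "(s, t) \<notin> E \<Longrightarrow> d s t = 0"
      using d(1) rc(1)[OF s] rc(1)[OF t] by blast+
  qed
qed

text \<open>The outgoing flow is a parameter \<open>w\<close>, so that one predicate serves both
  branches of \<open>outflow\<close>, of which only one involves a second member of
  \<open>T\<close>.\<close>

definition good_ring_flow :: "'a set \<Rightarrow> ('a \<Rightarrow> real) \<Rightarrow> ('a \<times> 'a \<Rightarrow> int) \<Rightarrow> bool" where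
  "good_ring_flow K w c \<longleftrightarrow>
     (\<forall>s\<in>ring K. \<forall>t\<in>ring K. c (s, t) = - c (t, s) \<and> ((s, t) \<notin> E \<longrightarrow> c (s, t) = 0) \<and>
        \<bar>of_int (c (s, t)) - \<phi> (s, t)\<bar> < 3) \<and>
     (\<forall>s\<in>ring K. (\<Sum>t\<in>ring K. of_int (c (s, t))) +
        (\<Sum>t\<in>collar K - ring K. of_int (bdy K (s, t))) + w s = of_int (f s))"

text \<open>Once \<phi> is corrected inside the ring by the two circulations, each row sum is
  \<open>f\<close> minus the integral values already fixed towards the children and the parent. It
  is therefore an integer and the matrix can be rounded.\<close>

lemma good_ring_flow_exists:
  assumes K: "K \<in> T"
  shows "\<exists>m. good_ring_flow K (outflow K) (F m)"
proof -
  define R where "R = ring K"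
  have finR: "finite R" using K by (simp add: R_def finite_ring)
  obtain e :: "'a \<Rightarrow> 'a \<Rightarrow> real" where
    e: "\<forall>s\<in>R. \<forall>t\<in>R. e s t = - e t s \<and> \<bar>e s t\<bar> < 1 \<and> ((s, t) \<notin> E \<longrightarrow> e s t = 0)"
      "\<forall>s\<in>R. (\<Sum>t\<in>R. e s t) = out K s - outflow K s \<and> outflow K s \<in> \<int>"
    unfolding R_def using parent_outflow[OF K] by blast
  obtain d :: "'a \<Rightarrow> 'a \<Rightarrow> real" where
    d: "\<forall>s\<in>collar K. \<forall>t\<in>collar K. d s t = - d t s \<and> \<bar>d s t\<bar> < 1 \<and> ((s, t) \<notin> E \<longrightarrow> d s t = 0) \<and>
       (cell s \<noteq> cell t \<longrightarrow> of_int (bdy K (s, t)) = \<phi> (s, t) + d s t)"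
      "\<forall>s\<in>collar K. (\<Sum>t\<in>collar K. d s t) = 0"
    using circulation[OF K] by blast
  have RC: "R \<subseteq> collar K" by (simp add: R_def ring_subset_collar)
  have cR: "cell s = K" if "s \<in> R" for s using that K by (simp add: R_def ring_iff)
  have cC: "cell t \<noteq> K" if "t \<in> collar K - R" for t
    using that K collar_subset by (auto simp: R_def ring_iff)
  define u where "u s t = \<phi> (s, t) + d s t + e s t" for s t
  define b where "b s = (\<Sum>t\<in>collar K - R. bdy K (s, t))" for s
  have u_antisym: "u s t = - u t s" if st: "s \<in> R" "t \<in> R" for s t
  proof -
    have "e s t = - e t s" "d s t = - d t s" using e(1) d(1) RC st by blast+
    then show ?thesis using \<phi>_antisym[of s t] by (simp add: u_def)
  qed
  have row: "(\<Sum>t\<in>R. u s t) = of_int (f s) - of_int (b s) - outflow K s" if s: "s \<in> R" for s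
  proof -
    have sC: "s \<in> collar K" using s RC by blast
    have "of_int (b s) = (\<Sum>t\<in>collar K - R. \<phi> (s, t) + d s t)"
      unfolding b_def of_int_sum
    proof (rule sum.cong[OF refl])
      fix t assume "t \<in> collar K - R"
      then have "t \<in> collar K" "cell s \<noteq> cell t" using cC cR[OF s] by auto
      then show "of_int (bdy K (s, t)) = \<phi> (s, t) + d s t" using d(1) sC by blast
    qed
    then have b: "of_int (b s) = (\<Sum>t\<in>collar K - R. \<phi> (s, t)) + (\<Sum>t\<in>collar K - R. d s t)"
      by (simp add: sum.distrib)
    have "(\<Sum>t\<in>collar K. d s t) = (\<Sum>t\<in>collar K - R. d s t) + (\<Sum>t\<in>R. d s t)"
      using RC finite_collar[OF K] by (intro sum.subset_diff)
    moreover have "(\<Sum>t\<in>collar K. \<phi> (s, t)) = (\<Sum>t\<in>collar K - R. \<phi> (s, t)) + (\<Sum>t\<in>R. \<phi> (s, t))"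
      using RC finite_collar[OF K] by (intro sum.subset_diff)
    \<comment> \<open>Vertices of \<open>K\<close> below the collar have no neighbour in the ring of
      \<open>K\<close>, because edges do not skip levels.\<close>
    moreover have "(\<Sum>t\<in>collar K. \<phi> (s, t)) = (\<Sum>t\<in>K. \<phi> (s, t))"
    proof (rule sum.mono_neutral_left[OF toast_finite[OF K] collar_subset], intro ballI)
      fix t assume t: "t \<in> K - collar K"
      have "(s, t) \<notin> E"
      proof
        assume st: "(s, t) \<in> E"
        have "t \<notin> ring K" using t ring_subset_collar by blast
        then have "cell t \<noteq> K" using t K by (auto simp: ring_iff)
        then have "cell t \<subset> cell s" using cell(3)[OF K, of t] t cR[OF s] by blast
        then show False using edge_collar(1)[OF symD[OF symE st]] cR[OF s] t by simp
      qed
      then show "\<phi> (s, t) = 0" by (rule \<phi>_supp)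
    qed
    moreover have "(\<Sum>t\<in>collar K. d s t) = 0" using d(2) sC by blast
    moreover have "(\<Sum>t\<in>R. e s t) = of_int (f s) - (\<Sum>t\<in>K. \<phi> (s, t)) - outflow K s"
      using e(2) s by (simp add: out_def)
    ultimately show ?thesis using b by (simp add: u_def sum.distrib)
  qed
  have int: "(\<Sum>t\<in>R. u s t) \<in> \<int>" if "s \<in> R" for s
    using row[OF that] e(2) that by auto
  obtain c :: "'a \<Rightarrow> 'a \<Rightarrow> int" where
    c: "\<And>s t. s \<in> R \<Longrightarrow> t \<in> R \<Longrightarrow> c s t = - c t s"
      "\<And>s t. s \<in> R \<Longrightarrow> t \<in> R \<Longrightarrow> \<bar>of_int (c s t) - u s t\<bar> < 1"
      "\<And>s. s \<in> R \<Longrightarrow> (\<Sum>t\<in>R. of_int (c s t)) = (\<Sum>t\<in>R. u s t)"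
    using antisym_matrix_rounding[where y = u, OF finR u_antisym int] by blast
  obtain m where m: "\<And>s t. s \<in> R \<Longrightarrow> t \<in> R \<Longrightarrow> F m (s, t) = c s t"
    using F_interp[of "R \<times> R" "\<lambda>(s, t). c s t"] finR by fastforce
  have "good_ring_flow K (outflow K) (F m)"
    unfolding good_ring_flow_def R_def[symmetric]
  proof (intro conjI ballI impI)
    fix s t assume st: "s \<in> R" "t \<in> R"
    have de: "\<bar>d s t\<bar> < 1" "\<bar>e s t\<bar> < 1" "(s, t) \<notin> E \<Longrightarrow> d s t = 0" "(s, t) \<notin> E \<Longrightarrow> e s t = 0"
      using d(1) e(1) RC st by blast+
    show "F m (s, t) = - F m (t, s)" using c(1)[OF st] m st by simp
    show "\<bar>of_int (F m (s, t)) - \<phi> (s, t)\<bar> < 3"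
      using c(2)[OF st] de(1,2) unfolding m[OF st] u_def by linarith
    show "F m (s, t) = 0" if "(s, t) \<notin> E"
      using c(2)[OF st] de(3,4)[OF that] \<phi>_supp[OF that] unfolding m[OF st] u_def by simp
  next
    fix s assume s: "s \<in> R"
    then have "(\<Sum>t\<in>R. of_int (F m (s, t))) = (\<Sum>t\<in>R. u s t)" using c(3) m by simp
    then show "(\<Sum>t\<in>R. of_int (F m (s, t))) + (\<Sum>t\<in>collar K - R. of_int (bdy K (s, t))) + outflow K s
        = of_int (f s)"
      using row[OF s] by (simp add: b_def)
  qed
  then show ?thesis by blast
qed

section \<open>The integral flow\<close>

definition ring_flow :: "'a set \<Rightarrow> ('a \<Rightarrow> real) \<Rightarrow> 'a \<times> 'a \<Rightarrow> int" where
  "ring_flow K w = F (LEAST m. good_ring_flow K w (F m))"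

lemma good_ring_flow: "K \<in> T \<Longrightarrow> good_ring_flow K (outflow K) (ring_flow K (outflow K))"
  unfolding ring_flow_def using LeastI_ex[OF good_ring_flow_exists] by blast

text \<open>Of two nested cells the union is the larger one, so both orientations of a boundary edge
  are read off from the same collar.\<close>

definition \<psi> :: "'a \<times> 'a \<Rightarrow> int" where
  "\<psi> = (\<lambda>(x, y). if cell x = cell y then ring_flow (cell x) (outflow (cell x)) (x, y)
     else bdy (cell x \<union> cell y) (x, y))"

lemma \<psi>_same: "cell x = cell y \<Longrightarrow> \<psi> (x, y) = ring_flow (cell x) (outflow (cell x)) (x, y)"
  by (simp add: \<psi>_def)

lemma \<psi>_sub: "cell x \<subset> cell y \<Longrightarrow> \<psi> (x, y) = bdy (cell y) (x, y) \<and> \<psi> (y, x) = bdy (cell y) (y, x)"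
  by (auto simp: \<psi>_def Un_absorb1 Un_absorb2 psubset_imp_subset)

lemma \<psi>_edge:
  assumes "(x, y) \<in> E"
  shows "\<psi> (x, y) = - \<psi> (y, x)" "\<bar>\<phi> (x, y) - of_int (\<psi> (x, y))\<bar> < 3"
proof -
  have sub: "\<psi> (x, y) = - \<psi> (y, x) \<and> \<bar>\<phi> (x, y) - of_int (\<psi> (x, y))\<bar> < 3"
    if xy: "(x, y) \<in> E" "cell x \<subset> cell y" for x y
  proof -
    note c = cell_edge[OF xy(1)] and k = edge_collar[OF xy]
    have y: "y \<in> collar (cell y)" using k(2) ring_subset_collar by blast
    obtain d :: "'a \<Rightarrow> 'a \<Rightarrow> real" where "\<bar>d x y\<bar> < 1" "of_int (bdy (cell y) (x, y)) = \<phi> (x, y) + d x y"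
      using circulation[OF c(3)] k(1) y xy(2) by blast
    then show ?thesis using \<psi>_sub[OF xy(2)] bdy_antisym[OF c(3) k(1) y] by simp
  qed
  note c = cell_edge[OF assms]
  have "\<psi> (x, y) = - \<psi> (y, x) \<and> \<bar>\<phi> (x, y) - of_int (\<psi> (x, y))\<bar> < 3"
  proof (cases "cell x = cell y")
    case True
    then have "x \<in> ring (cell x)" "y \<in> ring (cell x)" using c by (simp_all add: ring_iff)
    then have "ring_flow (cell x) (outflow (cell x)) (x, y) = - ring_flow (cell x) (outflow (cell x)) (y, x)"
        "\<bar>of_int (ring_flow (cell x) (outflow (cell x)) (x, y)) - \<phi> (x, y)\<bar> < 3"
      using good_ring_flow[OF c(1)] unfolding good_ring_flow_def by blast+
    moreover have "\<psi> (x, y) = ring_flow (cell x) (outflow (cell x)) (x, y)"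
      "\<psi> (y, x) = ring_flow (cell x) (outflow (cell x)) (y, x)"
      using True \<psi>_same by metis+
    ultimately show ?thesis by (simp only: abs_minus_commute)
  next
    case False
    then consider "cell x \<subset> cell y" | "cell y \<subset> cell x" using c(5) by blast
    then show ?thesis
    proof cases
      case 1 then show ?thesis using sub assms by blast
    next
      case 2
      then have "\<psi> (y, x) = - \<psi> (x, y)" "\<bar>\<phi> (y, x) - of_int (\<psi> (y, x))\<bar> < 3"
        using sub[OF symD[OF symE assms]] by blast+
      then show ?thesis using \<phi>_antisym[of y x] by simp
    qed
  qed
  then show "\<psi> (x, y) = - \<psi> (y, x)" "\<bar>\<phi> (x, y) - of_int (\<psi> (x, y))\<bar> < 3" by blast+
qed

lemma \<psi>_flow: "(\<Sum>y\<in>E `` {x}. of_int (\<psi> (x, y)) :: real) = of_int (f x)"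
proof (cases "E `` {x} = {}")
  \<comment> \<open>An isolated vertex need not lie in any member; there \<open>f\<close> is 0
    because \<phi> is a flow.\<close>
  case True
  then show ?thesis using \<phi>_flow[of x] by simp
next
  case False
  then obtain z where "(x, z) \<in> E" by blast
  note c = cell_edge(1,2)[OF this]
  define K where "K = cell x"
  define N where "N = E `` {x}"
  have K: "K \<in> T" and x: "x \<in> ring K" "x \<in> K" using c by (simp_all add: K_def ring_iff)
  have finN: "finite N" using locfin by (simp add: N_def locally_finite_graph_def)
  have g: "\<And>s t. s \<in> ring K \<Longrightarrow> t \<in> ring K \<Longrightarrow> (s, t) \<notin> E \<Longrightarrow> ring_flow K (outflow K) (s, t) = 0"
    "(\<Sum>t\<in>ring K. of_int (ring_flow K (outflow K) (x, t))) +
      (\<Sum>t\<in>collar K - ring K. of_int (bdy K (x, t))) + outflow K x = (of_int (f x) :: real)"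
    using good_ring_flow[OF K] x unfolding good_ring_flow_def by blast+
  have eN: "(x, t) \<in> E" if "t \<in> N" for t using that by (simp add: N_def)
  have s1: "(\<Sum>t\<in>N \<inter> ring K. of_int (\<psi> (x, t)) :: real) = (\<Sum>t\<in>ring K. of_int (ring_flow K (outflow K) (x, t)))"
  proof (rule sum.mono_neutral_cong_left)
    show "finite (ring K)" using K by (rule finite_ring)
    show "\<forall>t\<in>ring K - N \<inter> ring K. of_int (ring_flow K (outflow K) (x, t)) = (0::real)"
      using g(1) x by (auto simp: N_def)
    show "of_int (\<psi> (x, t)) = (of_int (ring_flow K (outflow K) (x, t)) :: real)" if "t \<in> N \<inter> ring K" for t
      using that K \<psi>_same[of x t] by (simp add: ring_iff K_def)
  qed simp
  have s2: "(\<Sum>t\<in>N \<inter> K - ring K. of_int (\<psi> (x, t)) :: real) = (\<Sum>t\<in>collar K - ring K. of_int (bdy K (x, t)))"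
  proof (rule sum.mono_neutral_cong_left)
    have sub: "cell t \<subset> cell x" if "t \<in> N \<inter> K - ring K" for t
      using that K cell(3)[OF K, of t] by (auto simp: ring_iff K_def)
    show "finite (collar K - ring K)" using K finite_collar by simp
    show "N \<inter> K - ring K \<subseteq> collar K - ring K"
      using sub edge_collar(1)[OF symD[OF symE eN]] by (auto simp: K_def)
    show "\<forall>t\<in>collar K - ring K - (N \<inter> K - ring K). of_int (bdy K (x, t)) = (0::real)"
    proof
      fix t assume t: "t \<in> collar K - ring K - (N \<inter> K - ring K)"
      then have "(x, t) \<notin> E" using collar_subset by (auto simp: N_def)
      moreover have "x \<in> collar K" using x(1) ring_subset_collar by blast
      ultimately show "of_int (bdy K (x, t)) = (0::real)" using bdy_supp[OF K] t by simp
    qed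
    show "of_int (\<psi> (x, t)) = (of_int (bdy K (x, t)) :: real)" if "t \<in> N \<inter> K - ring K" for t
      using \<psi>_sub[OF sub[OF that]] by (simp add: K_def)
  qed
  have s3: "(\<Sum>t\<in>N - K. of_int (\<psi> (x, t)) :: real) = outflow K x"
  proof (cases "\<exists>M. parent K M")
    case False
    then have "N - K = {}" using no_parent_edge[OF K False x(1)] by (auto simp: N_def)
    moreover have "integral_out K" using no_parent_out[OF K False] by (simp add: integral_out_def)
    ultimately show ?thesis using no_parent_out[OF K False x(1)] by (simp only: outflow_def if_True sum.empty)
  next
    case True
    then obtain M where par: "parent K M" by blast
    then have M: "M \<in> T" "K \<subset> M" by (auto simp: parent_def)
    have sub: "cell x \<subset> cell t \<and> cell t = M" if "t \<in> N - K" for t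
    proof -
      have e: "(x, t) \<in> E" using eN that by blast
      have "\<not> cell t \<subseteq> cell x" using cell_edge(4)[OF e] that by (auto simp: K_def)
      then have sub: "cell x \<subset> cell t" using cell_edge(5)[OF e] by blast
      then have "parent K (cell t)" using edge_parent[OF e] by (simp add: K_def)
      then show ?thesis using sub parent_unique[OF _ par] x(2) by blast
    qed
    have "(\<Sum>t\<in>N - K. of_int (\<psi> (x, t)) :: real) = bdy_out M x"
      unfolding bdy_out_def
    proof (rule sum.mono_neutral_cong_left)
      show "finite (ring M)" using M finite_ring by blast
      show "N - K \<subseteq> ring M"
      proof
        fix t assume t: "t \<in> N - K"
        then have "t \<in> cell t" "cell t = M" using sub cell_edge(4)[OF eN] by blast+
        then show "t \<in> ring M" using M(1) by (simp add: ring_iff)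
      qed
      show "of_int (\<psi> (x, t)) = (of_int (bdy M (x, t)) :: real)" if "t \<in> N - K" for t
        using \<psi>_sub[of x t] sub[OF that] by auto
      show "\<forall>t\<in>ring M - (N - K). of_int (bdy M (x, t)) = (0::real)"
      proof
        fix t assume t: "t \<in> ring M - (N - K)"
        have "t \<notin> K" using t M cell(3)[OF K, of t] by (auto simp: ring_iff)
        then have "(x, t) \<notin> E" using t by (auto simp: N_def)
        then show "of_int (bdy M (x, t)) = (0::real)"
          using bdy_supp[OF M(1) parent_collar[OF K par x(1)]] t ring_subset_collar by auto
      qed
    qed
    then show ?thesis using parent_outflow[OF K] par x(1) by metis
  qed
  \<comment> \<open>Neighbours in the same ring, in child rings and in the parent ring contribute
    exactly the three summands of \<open>good_ring_flow\<close>.\<close>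
  have "N = (N \<inter> ring K \<union> (N \<inter> K - ring K)) \<union> (N - K)"
    using ring_def by blast
  then have "(\<Sum>t\<in>N. of_int (\<psi> (x, t)) :: real) =
      (\<Sum>t\<in>N \<inter> ring K \<union> (N \<inter> K - ring K). of_int (\<psi> (x, t))) + (\<Sum>t\<in>N - K. of_int (\<psi> (x, t)))"
    using finN by (subst sum.union_disjoint[symmetric]) (auto simp: ring_def)
  also have "(\<Sum>t\<in>N \<inter> ring K \<union> (N \<inter> K - ring K). of_int (\<psi> (x, t)) :: real) =
      (\<Sum>t\<in>N \<inter> ring K. of_int (\<psi> (x, t))) + (\<Sum>t\<in>N \<inter> K - ring K. of_int (\<psi> (x, t)))"
    using finN by (intro sum.union_disjoint) auto
  finally show ?thesis using s1 s2 s3 g(2) by (simp add: N_def)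
qed

text \<open>Vertices of \<open>K\<close> are told apart by members inside \<open>K\<close> alone,
  which makes equality of cells a finite condition on an enumeration of \<open>K\<close>.\<close>

lemma cell_eq_iff:
  assumes "K \<in> T" "s \<in> K" "t \<in> K"
  shows "cell s = cell t \<longleftrightarrow> (\<forall>L\<in>T. L \<subseteq> K \<longrightarrow> s \<in> L \<longleftrightarrow> t \<in> L)"
proof
  assume "cell s = cell t"
  then show "\<forall>L\<in>T. L \<subseteq> K \<longrightarrow> s \<in> L \<longleftrightarrow> t \<in> L"
    using cell(2)[OF assms(1,2)] cell(2)[OF assms(1,3)] cell(3) by blast
next
  assume eq: "\<forall>L\<in>T. L \<subseteq> K \<longrightarrow> s \<in> L \<longleftrightarrow> t \<in> L"
  note s = cell[OF assms(1,2)] and t = cell[OF assms(1,3)]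
  have "t \<in> cell s" "s \<in> cell t" using eq s t by blast+
  then show "cell s = cell t" using cell(3)[OF s(1)] cell(3)[OF t(1)] by blast
qed

end

section \<open>Measurability\<close>

lemma pred_eq_borel:
  fixes a b :: "'w \<Rightarrow> 'a::{second_countable_topology, t2_space}"
  assumes "a \<in> \<Omega> \<rightarrow>\<^sub>M borel" "b \<in> \<Omega> \<rightarrow>\<^sub>M borel"
  shows "Measurable.pred \<Omega> (\<lambda>\<omega>. a \<omega> = b \<omega>)"
proof -
  have "closed {p :: 'a \<times> 'a. fst p = snd p}" by (intro closed_Collect_eq continuous_intros)
  then have D: "{p :: 'a \<times> 'a. fst p = snd p} \<in> sets borel" by (rule borel_closed)
  have "(\<lambda>\<omega>. (a \<omega>, b \<omega>)) \<in> \<Omega> \<rightarrow>\<^sub>M borel" using assms by simp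
  from measurable_sets[OF this D]
  have "(\<lambda>\<omega>. (a \<omega>, b \<omega>)) -` {p. fst p = snd p} \<inter> space \<Omega> \<in> sets \<Omega>" .
  moreover have "(\<lambda>\<omega>. (a \<omega>, b \<omega>)) -` {p. fst p = snd p} \<inter> space \<Omega> = {\<omega> \<in> space \<Omega>. a \<omega> = b \<omega>}" by auto
  ultimately show ?thesis by (simp add: pred_def)
qed

lemma pred_in_borel:
  assumes "a \<in> \<Omega> \<rightarrow>\<^sub>M borel" "S \<in> sets borel"
  shows "Measurable.pred \<Omega> (\<lambda>\<omega>. a \<omega> \<in> S)"
  using measurable_sets[OF assms] by (simp add: pred_def vimage_def Int_def conj_commute)

text \<open>On a generator, the condition just says that one of the listed points lies in an open
  set. Through this map the Borel set \<open>T\<close> of finite sets becomes a Borel condition on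
  enumerations.\<close>

lemma measurable_finite_image:
  fixes v :: "'i \<Rightarrow> 'w \<Rightarrow> 'a::polish_space"
  assumes I: "finite I" and v: "\<And>i. i \<in> I \<Longrightarrow> v i \<in> \<Omega> \<rightarrow>\<^sub>M borel"
  shows "(\<lambda>\<omega>. (\<lambda>i. v i \<omega>) ` I) \<in> \<Omega> \<rightarrow>\<^sub>M finite_sets_borel"
  unfolding finite_sets_borel_def
proof (rule measurable_measure_of)
  show "(\<lambda>\<omega>. (\<lambda>i. v i \<omega>) ` I) \<in> space \<Omega> \<rightarrow> {K. finite K}" using I by auto
  fix A :: "'a set set" assume "A \<in> {{K. finite K \<and> K \<inter> U \<noteq> {}} |U. open U}"
  then obtain U where U: "A = {K. finite K \<and> K \<inter> U \<noteq> {}}" "open U" by blast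
  have "Measurable.pred \<Omega> (\<lambda>\<omega>. \<exists>i\<in>I. v i \<omega> \<in> U)"
    using I v U(2) by (intro pred_intros_finite pred_in_borel) auto
  moreover have "(\<lambda>\<omega>. (\<lambda>i. v i \<omega>) ` I) -` A \<inter> space \<Omega> = {\<omega> \<in> space \<Omega>. \<exists>i\<in>I. v i \<omega> \<in> U}"
    using I by (auto simp: U(1))
  ultimately show "(\<lambda>\<omega>. (\<lambda>i. v i \<omega>) ` I) -` A \<inter> space \<Omega> \<in> sets \<Omega>" by (simp add: pred_def)
qed auto

locale borel_toast_flow = toast_flow +
  assumes E_borel: "E \<in> sets borel" and T_borel: "T \<in> sets finite_sets_borel"
    and \<phi>_borel: "\<phi> \<in> borel_measurable borel"
    and f_borel: "(\<lambda>x. real_of_int (f x)) \<in> borel_measurable borel"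
    and F_borel: "\<And>m. F m \<in> borel \<rightarrow>\<^sub>M count_space UNIV"
    and G_borel: "\<And>m. G m \<in> borel \<rightarrow>\<^sub>M count_space UNIV"

text \<open>A member of \<open>T\<close> varying with \<omega>, listed without repetition by Borel
  functions. Keeping \<Omega> abstract allows restricting to the \<omega> for which the listing is
  correct, and listing two members over the same space.\<close>

locale enumerated_toast = borel_toast_flow E T f \<phi> F G
  for E :: "('a::polish_space \<times> 'a) set" and T f \<phi> F G +
  fixes \<Omega> :: "'w measure" and n :: nat and v :: "nat \<Rightarrow> 'w \<Rightarrow> 'a" and K :: "'w \<Rightarrow> 'a set"
  assumes v_borel: "\<And>i. v i \<in> \<Omega> \<rightarrow>\<^sub>M borel"
    and K: "\<And>\<omega>. \<omega> \<in> space \<Omega> \<Longrightarrow> K \<omega> = (\<lambda>i. v i \<omega>) ` {..<n}"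
    and v_inj: "\<And>\<omega>. \<omega> \<in> space \<Omega> \<Longrightarrow> inj_on (\<lambda>i. v i \<omega>) {..<n}"
    and K_T: "\<And>\<omega>. \<omega> \<in> space \<Omega> \<Longrightarrow> K \<omega> \<in> T"
begin

abbreviation "P \<equiv> Measurable.pred \<Omega>"

section \<open>Finite quantifiers over an enumerated member\<close>

definition sub :: "nat set \<Rightarrow> 'w \<Rightarrow> 'a set" where
  "sub I \<omega> = (\<lambda>i. v i \<omega>) ` I"

lemma pred_sub_in_T:
  assumes "finite I" shows "P (\<lambda>\<omega>. sub I \<omega> \<in> T)"
  using measurable_sets[OF measurable_finite_image[OF assms v_borel] T_borel]
  by (simp add: pred_def vimage_def Int_def conj_commute sub_def)

lemma pred_mem_sub:
  assumes "finite I" "a \<in> \<Omega> \<rightarrow>\<^sub>M borel"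
  shows "P (\<lambda>\<omega>. a \<omega> \<in> sub I \<omega>)"
proof -
  have "P (\<lambda>\<omega>. \<exists>i\<in>I. a \<omega> = v i \<omega>)"
    using assms v_borel by (intro pred_intros_finite pred_eq_borel) auto
  moreover have "(\<lambda>\<omega>. \<exists>i\<in>I. a \<omega> = v i \<omega>) = (\<lambda>\<omega>. a \<omega> \<in> sub I \<omega>)" by (auto simp: sub_def)
  ultimately show ?thesis by simp
qed

lemma v_mem: "\<omega> \<in> space \<Omega> \<Longrightarrow> i < n \<Longrightarrow> v i \<omega> \<in> K \<omega>"
  by (simp add: K)

lemma pred_mem_K: "a \<in> \<Omega> \<rightarrow>\<^sub>M borel \<Longrightarrow> P (\<lambda>\<omega>. a \<omega> \<in> K \<omega>)"
  using pred_mem_sub[of "{..<n}" a] by (subst measurable_cong[OF arg_cong2[of _ _ _ _ "(\<in>)"]]) (auto simp: sub_def K)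

lemma pred_ball:
  assumes "\<And>i. i < n \<Longrightarrow> P (\<lambda>\<omega>. Q \<omega> (v i \<omega>))"
  shows "P (\<lambda>\<omega>. \<forall>x\<in>K \<omega>. Q \<omega> x)"
proof -
  have "P (\<lambda>\<omega>. \<forall>i\<in>{..<n}. Q \<omega> (v i \<omega>))" using assms by (intro pred_intros_finite) auto
  moreover have "(\<forall>i\<in>{..<n}. Q \<omega> (v i \<omega>)) \<longleftrightarrow> (\<forall>x\<in>K \<omega>. Q \<omega> x)" if "\<omega> \<in> space \<Omega>" for \<omega>
    by (simp add: K[OF that])
  ultimately show ?thesis by (simp cong: measurable_cong)
qed

lemma sub_eq_iff:
  "\<omega> \<in> space \<Omega> \<Longrightarrow> I \<subseteq> {..<n} \<Longrightarrow> J \<subseteq> {..<n} \<Longrightarrow> sub I \<omega> = sub J \<omega> \<longleftrightarrow> I = J"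
  unfolding sub_def by (rule inj_on_image_eq_iff[OF v_inj])

lemma subset_K_sub:
  assumes "\<omega> \<in> space \<Omega>" "L \<subseteq> K \<omega>"
  obtains I where "I \<subseteq> {..<n}" "L = sub I \<omega>"
  using assms subset_imageE[of L "\<lambda>i. v i \<omega>" "{..<n}"] unfolding sub_def by (metis K)

text \<open>Subsets of \<open>K \<omega>\<close> are images of index sets, so this is a conjunction
  over the finite set \<open>Pow {..<n}\<close>.\<close>

lemma pred_ball_T_subset:
  assumes "\<And>I. I \<subseteq> {..<n} \<Longrightarrow> P (\<lambda>\<omega>. Q \<omega> (sub I \<omega>))"
  shows "P (\<lambda>\<omega>. \<forall>L\<in>T. L \<subseteq> K \<omega> \<longrightarrow> Q \<omega> L)"
proof -
  have "P (\<lambda>\<omega>. \<forall>I\<in>Pow {..<n}. sub I \<omega> \<in> T \<longrightarrow> Q \<omega> (sub I \<omega>))"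
    using assms
    by (intro pred_intros_finite pred_intros_logic pred_sub_in_T) (auto intro: finite_subset)
  moreover have "(\<forall>I\<in>Pow {..<n}. sub I \<omega> \<in> T \<longrightarrow> Q \<omega> (sub I \<omega>)) \<longleftrightarrow> (\<forall>L\<in>T. L \<subseteq> K \<omega> \<longrightarrow> Q \<omega> L)"
    if \<omega>: "\<omega> \<in> space \<Omega>" for \<omega>
  proof
    assume "\<forall>I\<in>Pow {..<n}. sub I \<omega> \<in> T \<longrightarrow> Q \<omega> (sub I \<omega>)"
    then show "\<forall>L\<in>T. L \<subseteq> K \<omega> \<longrightarrow> Q \<omega> L" by (metis PowI subset_K_sub[OF \<omega>])
  next
    assume Q: "\<forall>L\<in>T. L \<subseteq> K \<omega> \<longrightarrow> Q \<omega> L"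
    have "sub I \<omega> \<subseteq> K \<omega>" if "I \<in> Pow {..<n}" for I using that by (auto simp: K[OF \<omega>] sub_def)
    then show "\<forall>I\<in>Pow {..<n}. sub I \<omega> \<in> T \<longrightarrow> Q \<omega> (sub I \<omega>)" using Q by blast
  qed
  ultimately show ?thesis by (simp cong: measurable_cong)
qed

text \<open>Since the listing is injective, the truth value depends on \<open>I\<close>
  only.\<close>

lemma pred_sub_psubset_K: "I \<subseteq> {..<n} \<Longrightarrow> P (\<lambda>\<omega>. sub I \<omega> \<subset> K \<omega>)"
proof -
  assume I: "I \<subseteq> {..<n}"
  have "sub I \<omega> \<subset> K \<omega> \<longleftrightarrow> I \<noteq> {..<n}" if \<omega>: "\<omega> \<in> space \<Omega>" for \<omega>
    using sub_eq_iff[OF \<omega> I subset_refl] I unfolding K[OF \<omega>] by (auto simp: sub_def)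
  then show ?thesis by (simp cong: measurable_cong)
qed

lemma pred_ball_T_psubset:
  assumes "\<And>I. I \<subseteq> {..<n} \<Longrightarrow> P (\<lambda>\<omega>. Q \<omega> (sub I \<omega>))"
  shows "P (\<lambda>\<omega>. \<forall>L\<in>T. L \<subset> K \<omega> \<longrightarrow> Q \<omega> L)"
proof -
  have "P (\<lambda>\<omega>. \<forall>L\<in>T. L \<subseteq> K \<omega> \<longrightarrow> L \<subset> K \<omega> \<longrightarrow> Q \<omega> L)"
    by (intro pred_ball_T_subset pred_intros_logic assms pred_sub_psubset_K)
  moreover have "(\<lambda>\<omega>. \<forall>L\<in>T. L \<subseteq> K \<omega> \<longrightarrow> L \<subset> K \<omega> \<longrightarrow> Q \<omega> L) = (\<lambda>\<omega>. \<forall>L\<in>T. L \<subset> K \<omega> \<longrightarrow> Q \<omega> L)"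
    by (auto simp: fun_eq_iff)
  ultimately show ?thesis by simp
qed

lemma fin: "I \<subseteq> {..<n} \<Longrightarrow> finite I"
  using finite_subset by blast

lemma pred_cell_eq:
  assumes "i < n" "j < n"
  shows "P (\<lambda>\<omega>. cell (v i \<omega>) = cell (v j \<omega>))"
proof -
  have "P (\<lambda>\<omega>. \<forall>L\<in>T. L \<subseteq> K \<omega> \<longrightarrow> v i \<omega> \<in> L \<longleftrightarrow> v j \<omega> \<in> L)"
    by (intro pred_ball_T_subset pred_intros_logic pred_mem_sub fin v_borel)
  then show ?thesis
    using cell_eq_iff[OF K_T v_mem v_mem] assms by (simp cong: measurable_cong)
qed

lemma pred_ring:
  assumes "a \<in> \<Omega> \<rightarrow>\<^sub>M borel"
  shows "P (\<lambda>\<omega>. a \<omega> \<in> ring (K \<omega>))"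
proof -
  have "P (\<lambda>\<omega>. a \<omega> \<in> K \<omega> \<and> (\<forall>L\<in>T. L \<subset> K \<omega> \<longrightarrow> \<not> a \<omega> \<in> L))"
    by (intro pred_intros_logic pred_ball_T_psubset pred_mem_K pred_mem_sub fin assms)
  moreover have "(\<lambda>\<omega>. a \<omega> \<in> K \<omega> \<and> (\<forall>L\<in>T. L \<subset> K \<omega> \<longrightarrow> \<not> a \<omega> \<in> L)) = (\<lambda>\<omega>. a \<omega> \<in> ring (K \<omega>))"
    by (auto simp: ring_def fun_eq_iff)
  ultimately show ?thesis by simp
qed

lemma pred_collar:
  assumes "a \<in> \<Omega> \<rightarrow>\<^sub>M borel"
  shows "P (\<lambda>\<omega>. a \<omega> \<in> collar (K \<omega>))"
proof -
  have "P (\<lambda>\<omega>. sub I \<omega> = sub J \<omega>)" if "I \<subseteq> {..<n}" "J \<subseteq> {..<n}" for I J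
    using sub_eq_iff[OF _ that] by (simp cong: measurable_cong)
  then have "P (\<lambda>\<omega>. a \<omega> \<in> K \<omega> \<and> (\<forall>L\<in>T. L \<subset> K \<omega> \<longrightarrow> (\<forall>L'\<in>T. L' \<subset> K \<omega> \<longrightarrow>
      a \<omega> \<in> L \<and> a \<omega> \<in> L' \<longrightarrow> L = L')))"
    by (intro pred_intros_logic pred_ball_T_psubset pred_mem_K pred_mem_sub fin assms)
  moreover have "(\<lambda>\<omega>. a \<omega> \<in> K \<omega> \<and> (\<forall>L\<in>T. L \<subset> K \<omega> \<longrightarrow> (\<forall>L'\<in>T. L' \<subset> K \<omega> \<longrightarrow>
      a \<omega> \<in> L \<and> a \<omega> \<in> L' \<longrightarrow> L = L'))) = (\<lambda>\<omega>. a \<omega> \<in> collar (K \<omega>))"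
    by (auto simp: collar_def fun_eq_iff)
  ultimately show ?thesis by simp
qed

text \<open>A sum over a varying set becomes a sum over fixed indices with indicators; injectivity
  ensures that each vertex is counted once.\<close>

lemma measurable_sum_K:
  fixes g :: "'w \<Rightarrow> 'a \<Rightarrow> real"
  assumes "\<And>i. i < n \<Longrightarrow> P (\<lambda>\<omega>. v i \<omega> \<in> S \<omega>)" "\<And>i. i < n \<Longrightarrow> (\<lambda>\<omega>. g \<omega> (v i \<omega>)) \<in> borel_measurable \<Omega>"
    and "\<And>\<omega>. S \<omega> \<subseteq> K \<omega>"
  shows "(\<lambda>\<omega>. \<Sum>x\<in>S \<omega>. g \<omega> x) \<in> borel_measurable \<Omega>"
proof -
  have "(\<lambda>\<omega>. \<Sum>i<n. if v i \<omega> \<in> S \<omega> then g \<omega> (v i \<omega>) else 0) \<in> borel_measurable \<Omega>"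
    using assms(1,2) by (intro borel_measurable_sum measurable_If) (auto simp: pred_def)
  moreover have "(\<Sum>i<n. if v i \<omega> \<in> S \<omega> then g \<omega> (v i \<omega>) else 0) = (\<Sum>x\<in>S \<omega>. g \<omega> x)"
    if \<omega>: "\<omega> \<in> space \<Omega>" for \<omega>
  proof -
    have "(\<Sum>i<n. if v i \<omega> \<in> S \<omega> then g \<omega> (v i \<omega>) else 0) = (\<Sum>x\<in>K \<omega>. if x \<in> S \<omega> then g \<omega> x else 0)"
      unfolding K[OF \<omega>] using v_inj[OF \<omega>] by (simp add: sum.reindex)
    also have "\<dots> = (\<Sum>x\<in>S \<omega>. g \<omega> x)"
      using assms(3)[of \<omega>] K[OF \<omega>] by (intro sum.mono_neutral_cong_right) auto
    finally show ?thesis .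
  qed
  ultimately show ?thesis by (simp cong: measurable_cong)
qed

lemma measurable_apply:
  assumes "h \<in> borel \<rightarrow>\<^sub>M N" "a \<in> \<Omega> \<rightarrow>\<^sub>M borel"
  shows "(\<lambda>\<omega>. h (a \<omega>)) \<in> \<Omega> \<rightarrow>\<^sub>M N"
  using measurable_compose[OF assms(2,1)] .

lemma measurable_Pair_borel:
  fixes a :: "'w \<Rightarrow> 'b::second_countable_topology" and b :: "'w \<Rightarrow> 'c::second_countable_topology"
  assumes "a \<in> \<Omega> \<rightarrow>\<^sub>M borel" "b \<in> \<Omega> \<rightarrow>\<^sub>M borel"
  shows "(\<lambda>\<omega>. (a \<omega>, b \<omega>)) \<in> \<Omega> \<rightarrow>\<^sub>M borel"
  using assms by simp

section \<open>Borel dependence of the constructions on the enumeration\<close>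

lemma measurable_bd:
  assumes "i < n"
  shows "(\<lambda>\<omega>. bd (K \<omega>) (v i \<omega>)) \<in> borel_measurable \<Omega>"
  unfolding bd_def
proof (rule measurable_sum_K)
  fix j assume j: "j < n"
  show "(\<lambda>\<omega>. if cell (v j \<omega>) = cell (v i \<omega>) then 0 else \<phi> (v i \<omega>, v j \<omega>)) \<in> borel_measurable \<Omega>"
    using measurable_apply[OF \<phi>_borel measurable_Pair_borel[OF v_borel v_borel]] pred_cell_eq[OF j assms]
    by (intro measurable_If) (auto simp: pred_def)
qed (use pred_collar v_borel collar_subset in auto)

lemma measurable_ybal:
  assumes q: "q \<in> borel \<rightarrow>\<^sub>M count_space UNIV" and "i < n" "j < n"
  shows "(\<lambda>\<omega>. ybal (K \<omega>) q (v i \<omega>) (v j \<omega>)) \<in> borel_measurable \<Omega>"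
  unfolding ybal_def
proof (intro measurable_If measurable_sum_K)
  fix k assume k: "k < n"
  have "(\<lambda>\<omega>. q (v k \<omega>, v i \<omega>, v j \<omega>)) \<in> \<Omega> \<rightarrow>\<^sub>M count_space UNIV"
    by (intro measurable_apply[OF q] measurable_Pair_borel v_borel)
  then have "(\<lambda>\<omega>. real_of_int (q (v k \<omega>, v i \<omega>, v j \<omega>))) \<in> borel_measurable \<Omega>" by simp
  then show "(\<lambda>\<omega>. bd (K \<omega>) (v k \<omega>) * real_of_int (q (v k \<omega>, v i \<omega>, v j \<omega>))) \<in> borel_measurable \<Omega>"
    using measurable_bd[OF k] by (rule borel_measurable_times[rotated])
next
  show "(\<lambda>\<omega>. \<phi> (v i \<omega>, v j \<omega>)) \<in> borel_measurable \<Omega>"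
    by (intro measurable_apply[OF \<phi>_borel] measurable_Pair_borel v_borel)
qed (use pred_collar v_borel collar_subset pred_cell_eq[OF assms(2,3)] in \<open>auto simp: pred_def\<close>)

lemma measurable_int:
  assumes "c \<in> borel \<rightarrow>\<^sub>M count_space (UNIV :: int set)" "a \<in> \<Omega> \<rightarrow>\<^sub>M borel"
  shows "(\<lambda>\<omega>. real_of_int (c (a \<omega>))) \<in> borel_measurable \<Omega>"
  using measurable_apply[OF assms] by simp

lemma pred_E: "P (\<lambda>\<omega>. (v i \<omega>, v j \<omega>) \<in> E)"
  by (intro pred_in_borel E_borel measurable_Pair_borel v_borel)

lemma pred_real_eq:
  fixes g h :: "'w \<Rightarrow> real"
  assumes "g \<in> borel_measurable \<Omega>" "h \<in> borel_measurable \<Omega>"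
  shows "P (\<lambda>\<omega>. g \<omega> = h \<omega>)" "P (\<lambda>\<omega>. g \<omega> < h \<omega>)"
  using assms by measurable

lemma pred_ball_collar:
  assumes "\<And>i. i < n \<Longrightarrow> P (\<lambda>\<omega>. Q \<omega> (v i \<omega>))"
  shows "P (\<lambda>\<omega>. \<forall>x\<in>collar (K \<omega>). Q \<omega> x)"
proof -
  have "P (\<lambda>\<omega>. \<forall>x\<in>K \<omega>. x \<in> collar (K \<omega>) \<longrightarrow> Q \<omega> x)"
    by (intro pred_ball pred_intros_logic pred_collar v_borel assms)
  moreover have "(\<lambda>\<omega>. \<forall>x\<in>K \<omega>. x \<in> collar (K \<omega>) \<longrightarrow> Q \<omega> x) = (\<lambda>\<omega>. \<forall>x\<in>collar (K \<omega>). Q \<omega> x)"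
    using collar_subset by (fastforce simp: fun_eq_iff)
  ultimately show ?thesis by simp
qed

lemma pred_ball_ring:
  assumes "\<And>i. i < n \<Longrightarrow> P (\<lambda>\<omega>. Q \<omega> (v i \<omega>))"
  shows "P (\<lambda>\<omega>. \<forall>x\<in>ring (K \<omega>). Q \<omega> x)"
proof -
  have "P (\<lambda>\<omega>. \<forall>x\<in>K \<omega>. x \<in> ring (K \<omega>) \<longrightarrow> Q \<omega> x)"
    by (intro pred_ball pred_intros_logic pred_ring v_borel assms)
  moreover have "(\<lambda>\<omega>. \<forall>x\<in>K \<omega>. x \<in> ring (K \<omega>) \<longrightarrow> Q \<omega> x) = (\<lambda>\<omega>. \<forall>x\<in>ring (K \<omega>). Q \<omega> x)"
    by (auto simp: ring_def fun_eq_iff)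
  ultimately show ?thesis by simp
qed

lemma pred_good_bdy:
  assumes q: "q \<in> borel \<rightarrow>\<^sub>M count_space UNIV" and c: "c \<in> borel \<rightarrow>\<^sub>M count_space UNIV"
  shows "P (\<lambda>\<omega>. good_bdy (K \<omega>) q c)"
proof -
  have c': "(\<lambda>\<omega>. real_of_int (c (v i \<omega>, v j \<omega>))) \<in> borel_measurable \<Omega>" for i j
    by (intro measurable_int[OF c] measurable_Pair_borel v_borel)
  have q': "(\<lambda>\<omega>. real_of_int (q (v k \<omega>, v i \<omega>, v j \<omega>))) \<in> borel_measurable \<Omega>" for i j k
    by (intro measurable_int[OF q] measurable_Pair_borel v_borel)
  have ce: "P (\<lambda>\<omega>. c (v i \<omega>, v j \<omega>) = - c (v j \<omega>, v i \<omega>))" for i j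
  proof -
    have "P (\<lambda>\<omega>. real_of_int (c (v i \<omega>, v j \<omega>)) = - real_of_int (c (v j \<omega>, v i \<omega>)))"
      by (intro pred_real_eq borel_measurable_uminus c')
    then show ?thesis by (simp flip: of_int_minus)
  qed
  have qe: "P (\<lambda>\<omega>. q (v k \<omega>, v i \<omega>, v j \<omega>) \<noteq> 0)" for i j k
    using pred_intros_logic(2)[OF pred_real_eq(1)[OF q' borel_measurable_const[of 0]]] by simp
  show ?thesis
    unfolding good_bdy_def
    by (intro pred_intros_logic(2-5) pred_ball_collar pred_real_eq measurable_ybal[OF q] ce qe pred_E c'
        borel_measurable_uminus borel_measurable_abs borel_measurable_diff borel_measurable_const
        measurable_sum_K pred_collar v_borel collar_subset pred_cell_eq)
qed

text \<open>The existential over \<open>k\<close> is a countable union of Borel conditions, so the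
  least admissible \<open>m\<close> is Borel in \<omega>, and \<open>F m\<close> is evaluated
  separately for each of its countably many values.\<close>

lemma measurable_bdy:
  assumes "a \<in> \<Omega> \<rightarrow>\<^sub>M borel"
  shows "(\<lambda>\<omega>. bdy (K \<omega>) (a \<omega>)) \<in> \<Omega> \<rightarrow>\<^sub>M count_space UNIV"
  unfolding bdy_def
proof (rule measurable_compose_countable[where f = "\<lambda>m \<omega>. F m (a \<omega>)"])
  show "(\<lambda>\<omega>. F m (a \<omega>)) \<in> \<Omega> \<rightarrow>\<^sub>M count_space UNIV" for m
    by (rule measurable_apply[OF F_borel assms])
  show "(\<lambda>\<omega>. LEAST m. \<exists>k. good_bdy (K \<omega>) (G k) (F m)) \<in> \<Omega> \<rightarrow>\<^sub>M count_space UNIV"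
    by (intro measurable_Least pred_intros_countable pred_good_bdy F_borel G_borel)
qed

lemma measurable_bdy_real:
  assumes "a \<in> \<Omega> \<rightarrow>\<^sub>M borel"
  shows "(\<lambda>\<omega>. real_of_int (bdy (K \<omega>) (a \<omega>))) \<in> borel_measurable \<Omega>"
  using measurable_bdy[OF assms] by simp

lemma measurable_bdy_out:
  assumes "a \<in> \<Omega> \<rightarrow>\<^sub>M borel"
  shows "(\<lambda>\<omega>. bdy_out (K \<omega>) (a \<omega>)) \<in> borel_measurable \<Omega>"
  unfolding bdy_out_def
  by (intro measurable_sum_K measurable_bdy_real measurable_Pair_borel assms v_borel pred_ring)
    (auto simp: ring_def)

lemma measurable_out: "(\<lambda>\<omega>. out (K \<omega>) (v i \<omega>)) \<in> borel_measurable \<Omega>"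
  unfolding out_def
  by (intro borel_measurable_diff measurable_apply[OF f_borel] measurable_sum_K
      measurable_apply[OF \<phi>_borel] measurable_Pair_borel v_borel pred_mem_K subset_refl)

lemma pred_integral_out: "P (\<lambda>\<omega>. integral_out (K \<omega>))"
  unfolding integral_out_def
  by (intro pred_ball_ring pred_in_borel[OF measurable_out] borel_closed closed_Ints)

lemma pred_good_ring_flow:
  assumes c: "c \<in> borel \<rightarrow>\<^sub>M count_space UNIV"
    and w: "\<And>i. i < n \<Longrightarrow> (\<lambda>\<omega>. w \<omega> (v i \<omega>)) \<in> borel_measurable \<Omega>"
  shows "P (\<lambda>\<omega>. good_ring_flow (K \<omega>) (w \<omega>) c)"
proof -
  have c': "(\<lambda>\<omega>. real_of_int (c (v i \<omega>, v j \<omega>))) \<in> borel_measurable \<Omega>" for i j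
    by (intro measurable_int[OF c] measurable_Pair_borel v_borel)
  have ce: "P (\<lambda>\<omega>. c (v i \<omega>, v j \<omega>) = - c (v j \<omega>, v i \<omega>))" for i j
  proof -
    have "P (\<lambda>\<omega>. real_of_int (c (v i \<omega>, v j \<omega>)) = - real_of_int (c (v j \<omega>, v i \<omega>)))"
      by (intro pred_real_eq borel_measurable_uminus c')
    then show ?thesis by (simp flip: of_int_minus)
  qed
  have c0: "P (\<lambda>\<omega>. c (v i \<omega>, v j \<omega>) = 0)" for i j
    using pred_real_eq(1)[OF c' borel_measurable_const[of 0]] by simp
  have CR: "P (\<lambda>\<omega>. v i \<omega> \<in> collar (K \<omega>) - ring (K \<omega>))" for i
    by (intro pred_intros_logic pred_collar pred_ring v_borel)
  have R: "ring (K \<omega>) \<subseteq> K \<omega>" "collar (K \<omega>) - ring (K \<omega>) \<subseteq> K \<omega>" for \<omega>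
    using collar_subset by (auto simp: ring_def)
  show ?thesis
    unfolding good_ring_flow_def
    by (intro pred_intros_logic(2-5) pred_ball_ring pred_real_eq ce c0 pred_E c'
        borel_measurable_abs borel_measurable_diff borel_measurable_const borel_measurable_add
        measurable_sum_K pred_ring CR v_borel R measurable_bdy_real measurable_Pair_borel w
        measurable_apply[OF \<phi>_borel] measurable_apply[OF f_borel])
qed

lemma measurable_ring_flow:
  assumes "a \<in> \<Omega> \<rightarrow>\<^sub>M borel"
    and w: "\<And>i. i < n \<Longrightarrow> (\<lambda>\<omega>. w \<omega> (v i \<omega>)) \<in> borel_measurable \<Omega>"
  shows "(\<lambda>\<omega>. ring_flow (K \<omega>) (w \<omega>) (a \<omega>)) \<in> \<Omega> \<rightarrow>\<^sub>M count_space UNIV"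
  unfolding ring_flow_def
proof (rule measurable_compose_countable[where f = "\<lambda>m \<omega>. F m (a \<omega>)"])
  show "(\<lambda>\<omega>. F m (a \<omega>)) \<in> \<Omega> \<rightarrow>\<^sub>M count_space UNIV" for m
    by (rule measurable_apply[OF F_borel assms(1)])
  show "(\<lambda>\<omega>. LEAST m. good_ring_flow (K \<omega>) (w \<omega>) (F m)) \<in> \<Omega> \<rightarrow>\<^sub>M count_space UNIV"
    by (intro measurable_Least pred_good_ring_flow F_borel w)
qed

text \<open>The enumerated \<open>K\<close> plays the parent and \<open>u\<close> lists the
  candidate child. Seen from the parent, being a parent only involves members inside it, unlike the
  search for a parent from below.\<close>

lemma pred_parent:
  fixes u :: "nat \<Rightarrow> 'w \<Rightarrow> 'a"
  assumes u: "\<And>i. u i \<in> \<Omega> \<rightarrow>\<^sub>M borel"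
  shows "P (\<lambda>\<omega>. parent ((\<lambda>i. u i \<omega>) ` {..<m}) (K \<omega>))"
proof -
  have sub: "P (\<lambda>\<omega>. \<forall>i\<in>{..<m}. u i \<omega> \<in> sub I \<omega>)" if "I \<subseteq> {..<n}" for I
    using fin[OF that] u by (intro pred_intros_finite pred_mem_sub) auto
  have sup: "P (\<lambda>\<omega>. \<exists>i\<in>I. \<forall>j\<in>{..<m}. v i \<omega> \<noteq> u j \<omega>)" if "I \<subseteq> {..<n}" for I
    using fin[OF that] u v_borel
    by (intro pred_intros_finite pred_intros_logic pred_eq_borel) auto
  have ps: "P (\<lambda>\<omega>. (\<lambda>i. u i \<omega>) ` {..<m} \<subset> sub I \<omega>)" if "I \<subseteq> {..<n}" for I
  proof -
    have "(\<lambda>i. u i \<omega>) ` {..<m} \<subset> sub I \<omega> \<longleftrightarrow>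
        (\<forall>i\<in>{..<m}. u i \<omega> \<in> sub I \<omega>) \<and> (\<exists>i\<in>I. \<forall>j\<in>{..<m}. v i \<omega> \<noteq> u j \<omega>)" for \<omega>
      unfolding sub_def psubset_eq by blast
    then show ?thesis using sub[OF that] sup[OF that] by simp
  qed
  have "P (\<lambda>\<omega>. (\<lambda>i. u i \<omega>) ` {..<m} \<subset> sub {..<n} \<omega> \<and>
      (\<forall>L\<in>T. L \<subset> K \<omega> \<longrightarrow> \<not> (\<lambda>i. u i \<omega>) ` {..<m} \<subset> L))"
    by (intro pred_intros_logic pred_ball_T_psubset ps subset_refl)
  moreover have "(\<lambda>i. u i \<omega>) ` {..<m} \<subset> sub {..<n} \<omega> \<and>
      (\<forall>L\<in>T. L \<subset> K \<omega> \<longrightarrow> \<not> (\<lambda>i. u i \<omega>) ` {..<m} \<subset> L) \<longleftrightarrow> parent ((\<lambda>i. u i \<omega>) ` {..<m}) (K \<omega>)"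
    if \<omega>: "\<omega> \<in> space \<Omega>" for \<omega>
    unfolding parent_iff[OF K_T[OF \<omega>]] by (simp only: K[OF \<omega>] sub_def)
  ultimately show ?thesis by (simp cong: measurable_cong)
qed

end

section \<open>Level sets of the integral flow as projections\<close>

context borel_toast_flow
begin

lemma finite_enumeration:
  assumes "finite (S :: 'a set)"
  shows "\<exists>(n::nat) v. inj_on v {..<n} \<and> S = v ` {..<n}"
  using finite_imp_nat_seg_image_inj_on[OF assms] unfolding lessThan_def by metis

lemma parent_exists:
  assumes "K \<in> T" "\<not> integral_out K"
  shows "\<exists>M. parent K M"
  using no_parent_out[OF assms(1)] assms(2) unfolding integral_out_def by fastforce

text \<open>
  A witness \<open>(e, v, w)\<close> enumerates by \<open>v\<close> the least member of \<open>T\<close> containing both ends of \<open>e\<close>, and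
  by \<open>w\<close> its parent, when \<open>\<psi> e\<close> depends on it.
\<close>

definition lone_witness :: "int \<Rightarrow> nat \<Rightarrow> (('a \<times> 'a) \<times> (nat \<Rightarrow> 'a) \<times> (nat \<Rightarrow> 'a)) set" where
  "lone_witness j n = {(e, v, w). inj_on v {..<n} \<and> v ` {..<n} \<in> T \<and> e \<in> E \<and>
     fst e \<in> v ` {..<n} \<and> snd e \<in> v ` {..<n} \<and>
     (fst e \<in> ring (v ` {..<n}) \<and> snd e \<in> ring (v ` {..<n}) \<and> integral_out (v ` {..<n}) \<and>
        ring_flow (v ` {..<n}) (out (v ` {..<n})) e = j \<or>
      (fst e \<in> ring (v ` {..<n})) \<noteq> (snd e \<in> ring (v ` {..<n})) \<and> bdy (v ` {..<n}) e = j)}"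

definition parent_witness :: "int \<Rightarrow> nat \<Rightarrow> nat \<Rightarrow> (('a \<times> 'a) \<times> (nat \<Rightarrow> 'a) \<times> (nat \<Rightarrow> 'a)) set" where
  "parent_witness j n n' = {(e, v, w). inj_on v {..<n} \<and> v ` {..<n} \<in> T \<and>
     inj_on w {..<n'} \<and> w ` {..<n'} \<in> T \<and> e \<in> E \<and>
     fst e \<in> ring (v ` {..<n}) \<and> snd e \<in> ring (v ` {..<n}) \<and> \<not> integral_out (v ` {..<n}) \<and>
     parent (v ` {..<n}) (w ` {..<n'}) \<and> ring_flow (v ` {..<n}) (bdy_out (w ` {..<n'})) e = j}"

lemma \<psi>_in_ring:
  assumes "K \<in> T" "x \<in> ring K" "y \<in> ring K"
  shows "\<psi> (x, y) = ring_flow K (outflow K) (x, y)"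
  using \<psi>_same[of x y] assms by (simp add: ring_iff)

lemma \<psi>_off_ring:
  assumes "K \<in> T" "x \<in> K" "y \<in> K" "(x \<in> ring K) \<noteq> (y \<in> ring K)"
  shows "\<psi> (x, y) = bdy K (x, y)"
proof -
  have "cell x \<subseteq> K" "cell y \<subseteq> K" using cell(3)[OF assms(1)] assms(2,3) by blast+
  then have "cell x = K \<and> cell y \<subset> K \<or> cell y = K \<and> cell x \<subset> K"
    using assms by (auto simp: ring_iff)
  then show ?thesis using \<psi>_sub by metis
qed

text \<open>The values in the witness conditions depend on the enumerated sets only, not on the
  order of listing, and equal \<open>\<psi> e\<close> for any witness of \<open>e\<close>. So
  distinct \<open>j\<close> have disjoint projections. \<open>prod_decode\<close> merges the two
  lengths into one index.\<close>

lemma \<psi>_projection: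
  "{e \<in> E. \<psi> e = j} = (\<Union>i. fst ` (lone_witness j (fst (prod_decode i)) \<union>
     parent_witness j (fst (prod_decode i)) (snd (prod_decode i))))" (is "_ = ?U")
proof (intro equalityI subsetI)
  fix e assume "e \<in> {e \<in> E. \<psi> e = j}"
  then obtain x y where e: "e = (x, y)" "(x, y) \<in> E" "\<psi> (x, y) = j" by (cases e) auto
  have lone: "e \<in> ?U" if "(e, v, w) \<in> lone_witness j n" for n :: nat and v w
    using that by (intro UN_I[of "prod_encode (n, 0)"] image_eqI[of _ _ "(e, v, w)"]) auto
  have par: "e \<in> ?U" if "(e, v, w) \<in> parent_witness j n n'" for n n' :: nat and v w
    using that by (intro UN_I[of "prod_encode (n, n')"] image_eqI[of _ _ "(e, v, w)"]) auto
  note c = cell_edge[OF e(2)]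
  define K where "K = cell x \<union> cell y"
  have K: "K \<in> T" "x \<in> K" "y \<in> K"
    using c unfolding K_def by (cases "cell x = cell y"; auto simp: Un_absorb1 Un_absorb2 psubset_imp_subset)+
  obtain n :: nat and v where v: "inj_on v {..<n}" "K = v ` {..<n}"
    using finite_enumeration[OF toast_finite[OF K(1)]] by blast
  show "e \<in> ?U"
  proof (cases "cell x = cell y")
    case True
    then have R: "x \<in> ring K" "y \<in> ring K" using K by (auto simp: ring_iff K_def)
    show ?thesis
    proof (cases "integral_out K")
      case True
      \<comment> \<open>The third component is unconstrained in a lone witness, so \<open>v\<close>
        serves as a filler.\<close>
      have "(e, v, v) \<in> lone_witness j n"
        using \<psi>_in_ring[OF K(1) R] outflow_integral[OF True] True R K e v(1)
        by (simp add: lone_witness_def v(2)[symmetric])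
      then show ?thesis by (rule lone)
    next
      case False
      then obtain M where M: "parent K M" using parent_exists[OF K(1)] by blast
      then have "M \<in> T" by (simp add: parent_def)
      then obtain n' :: nat and w where w: "inj_on w {..<n'}" "M = w ` {..<n'}"
        using finite_enumeration[OF toast_finite, of M] by blast
      have "(e, v, w) \<in> parent_witness j n n'"
        using \<psi>_in_ring[OF K(1) R] outflow_parent[OF False M] False M R K e v(1) w(1) \<open>M \<in> T\<close>
        by (simp add: parent_witness_def v(2)[symmetric] w(2)[symmetric])
      then show ?thesis by (rule par)
    qed
  next
    case False
    then have "cell x \<subset> cell y \<or> cell y \<subset> cell x" using c(5) by blast
    then have R: "(x \<in> ring K) \<noteq> (y \<in> ring K)" using K by (auto simp: ring_iff K_def)
    have "(e, v, v) \<in> lone_witness j n"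
      using \<psi>_off_ring[OF K R] R K e v(1)
      by (simp add: lone_witness_def v(2)[symmetric])
    then show ?thesis by (rule lone)
  qed
next
  fix e assume "e \<in> ?U"
  then obtain n n' :: nat and v w where "(e, v, w) \<in> lone_witness j n \<or> (e, v, w) \<in> parent_witness j n n'"
    by (auto simp: image_iff) blast+
  moreover obtain x y where e: "e = (x, y)" by (cases e)
  ultimately show "e \<in> {e \<in> E. \<psi> e = j}"
    using \<psi>_in_ring[of "v ` {..<n}" x y] \<psi>_off_ring[of "v ` {..<n}" x y]
      outflow_integral[of "v ` {..<n}"] outflow_parent[of "v ` {..<n}"]
    unfolding lone_witness_def parent_witness_def by auto
qed

lemma witness_coordinates:
  "fst \<in> (borel :: (('a \<times> 'a) \<times> (nat \<Rightarrow> 'a) \<times> (nat \<Rightarrow> 'a)) measure) \<rightarrow>\<^sub>M borel"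
  "(\<lambda>\<omega>. fst (fst \<omega>)) \<in> (borel :: (('a \<times> 'a) \<times> (nat \<Rightarrow> 'a) \<times> (nat \<Rightarrow> 'a)) measure) \<rightarrow>\<^sub>M borel"
  "(\<lambda>\<omega>. snd (fst \<omega>)) \<in> (borel :: (('a \<times> 'a) \<times> (nat \<Rightarrow> 'a) \<times> (nat \<Rightarrow> 'a)) measure) \<rightarrow>\<^sub>M borel"
  "(\<lambda>\<omega>. fst (snd \<omega>) i) \<in> (borel :: (('a \<times> 'a) \<times> (nat \<Rightarrow> 'a) \<times> (nat \<Rightarrow> 'a)) measure) \<rightarrow>\<^sub>M borel"
  "(\<lambda>\<omega>. snd (snd \<omega>) i) \<in> (borel :: (('a \<times> 'a) \<times> (nat \<Rightarrow> 'a) \<times> (nat \<Rightarrow> 'a)) measure) \<rightarrow>\<^sub>M borel"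
  by (intro borel_measurable_continuous_onI continuous_intros continuous_on_product_then_coordinatewise)+

lemma enumerations_borel:
  fixes v :: "nat \<Rightarrow> 'w \<Rightarrow> 'a"
  assumes "\<And>i. v i \<in> \<Omega> \<rightarrow>\<^sub>M borel"
  shows "{\<omega> \<in> space \<Omega>. inj_on (\<lambda>i. v i \<omega>) {..<n} \<and> (\<lambda>i. v i \<omega>) ` {..<n} \<in> T} \<in> sets \<Omega>"
proof -
  have "Measurable.pred \<Omega> (\<lambda>\<omega>. \<forall>i\<in>{..<n}. \<forall>j\<in>{..<n}. v i \<omega> = v j \<omega> \<longrightarrow> i = j)"
    by (intro pred_intros_finite pred_intros_logic pred_eq_borel assms) auto
  moreover have "Measurable.pred \<Omega> (\<lambda>\<omega>. (\<lambda>i. v i \<omega>) ` {..<n} \<in> T)"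
    using measurable_sets[OF measurable_finite_image[OF _ assms] T_borel, of "{..<n}" "\<lambda>i. i"]
    by (simp add: pred_def vimage_def Int_def conj_commute)
  ultimately show ?thesis unfolding inj_on_def by measurable
qed

text \<open>On the Borel set \<open>D\<close> of correct enumerations the locale assumptions hold at
  every point, and a set that is Borel in \<open>D\<close> is Borel in the whole space.\<close>

lemma lone_witness_borel: "lone_witness j n \<in> sets borel"
proof -
  let ?B = "borel :: (('a \<times> 'a) \<times> (nat \<Rightarrow> 'a) \<times> (nat \<Rightarrow> 'a)) measure"
  define D where "D = {\<omega> \<in> space ?B. inj_on (\<lambda>i. fst (snd \<omega>) i) {..<n} \<and> (\<lambda>i. fst (snd \<omega>) i) ` {..<n} \<in> T}"
  define \<Omega> where "\<Omega> = restrict_space ?B D"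
  have D: "D \<in> sets ?B"
    unfolding D_def by (rule enumerations_borel[of "\<lambda>i \<omega>. fst (snd \<omega>) i" ?B n, OF witness_coordinates(4)])
  have sp: "space \<Omega> = D" by (simp add: \<Omega>_def space_restrict_space)
  note m = witness_coordinates[THEN measurable_restrict_space1[where \<Omega> = D], folded \<Omega>_def]
  interpret V: enumerated_toast E T f \<phi> F G \<Omega> n "\<lambda>i \<omega>. fst (snd \<omega>) i" "\<lambda>\<omega>. fst (snd \<omega>) ` {..<n}"
    by unfold_locales (auto simp: sp D_def intro: m)
  define Q where "Q \<omega> = (fst \<omega> \<in> E \<and>
     fst (fst \<omega>) \<in> fst (snd \<omega>) ` {..<n} \<and> snd (fst \<omega>) \<in> fst (snd \<omega>) ` {..<n} \<and>
     (fst (fst \<omega>) \<in> ring (fst (snd \<omega>) ` {..<n}) \<and> snd (fst \<omega>) \<in> ring (fst (snd \<omega>) ` {..<n}) \<and>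
        integral_out (fst (snd \<omega>) ` {..<n}) \<and>
        ring_flow (fst (snd \<omega>) ` {..<n}) (out (fst (snd \<omega>) ` {..<n})) (fst \<omega>) = j \<or>
      (fst (fst \<omega>) \<in> ring (fst (snd \<omega>) ` {..<n})) \<noteq> (snd (fst \<omega>) \<in> ring (fst (snd \<omega>) ` {..<n})) \<and>
        bdy (fst (snd \<omega>) ` {..<n}) (fst \<omega>) = j))" for \<omega> :: "('a \<times> 'a) \<times> (nat \<Rightarrow> 'a) \<times> (nat \<Rightarrow> 'a)"
  have in_j: "Measurable.pred \<Omega> (\<lambda>\<omega>. h \<omega> = j)" if "h \<in> \<Omega> \<rightarrow>\<^sub>M count_space UNIV" for h
    using that by simp
  have "Measurable.pred \<Omega> Q"
    unfolding Q_def
    by (intro pred_intros_logic(2-6) pred_in_borel[OF m(1) E_borel] V.pred_mem_K V.pred_ring m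
        V.pred_integral_out in_j V.measurable_ring_flow V.measurable_bdy V.measurable_out)
  then have "{\<omega> \<in> D. Q \<omega>} \<in> sets \<Omega>" by (simp add: pred_def sp)
  then have "{\<omega> \<in> D. Q \<omega>} \<in> sets ?B" using D by (simp add: \<Omega>_def sets_restrict_space_iff)
  moreover have "lone_witness j n = {\<omega> \<in> D. Q \<omega>}"
    by (auto simp: lone_witness_def D_def Q_def)
  ultimately show ?thesis by simp
qed

lemma parent_witness_borel: "parent_witness j n n' \<in> sets borel"
proof -
  let ?B = "borel :: (('a \<times> 'a) \<times> (nat \<Rightarrow> 'a) \<times> (nat \<Rightarrow> 'a)) measure"
  define D where "D = {\<omega> \<in> space ?B. inj_on (\<lambda>i. fst (snd \<omega>) i) {..<n} \<and> (\<lambda>i. fst (snd \<omega>) i) ` {..<n} \<in> T} \<inter>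
    {\<omega> \<in> space ?B. inj_on (\<lambda>i. snd (snd \<omega>) i) {..<n'} \<and> (\<lambda>i. snd (snd \<omega>) i) ` {..<n'} \<in> T}"
  define \<Omega> where "\<Omega> = restrict_space ?B D"
  have D: "D \<in> sets ?B"
    unfolding D_def
    by (intro sets.Int enumerations_borel[of "\<lambda>i \<omega>. fst (snd \<omega>) i" ?B n, OF witness_coordinates(4)]
        enumerations_borel[of "\<lambda>i \<omega>. snd (snd \<omega>) i" ?B n', OF witness_coordinates(5)])
  have sp: "space \<Omega> = D" by (simp add: \<Omega>_def space_restrict_space)
  note m = witness_coordinates[THEN measurable_restrict_space1[where \<Omega> = D], folded \<Omega>_def]
  interpret V: enumerated_toast E T f \<phi> F G \<Omega> n "\<lambda>i \<omega>. fst (snd \<omega>) i" "\<lambda>\<omega>. fst (snd \<omega>) ` {..<n}"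
    by unfold_locales (auto simp: sp D_def intro: m)
  \<comment> \<open>\<open>V\<close> and \<open>W\<close> share \<Omega>: the ring rounding is
    measured along \<open>V\<close> with an outgoing flow that is measured through
    \<open>W\<close>.\<close>
  interpret W: enumerated_toast E T f \<phi> F G \<Omega> n' "\<lambda>i \<omega>. snd (snd \<omega>) i" "\<lambda>\<omega>. snd (snd \<omega>) ` {..<n'}"
    by unfold_locales (auto simp: sp D_def intro: m)
  define Q where "Q \<omega> = (fst \<omega> \<in> E \<and> fst (fst \<omega>) \<in> ring (fst (snd \<omega>) ` {..<n}) \<and>
     snd (fst \<omega>) \<in> ring (fst (snd \<omega>) ` {..<n}) \<and> \<not> integral_out (fst (snd \<omega>) ` {..<n}) \<and>
     parent (fst (snd \<omega>) ` {..<n}) (snd (snd \<omega>) ` {..<n'}) \<and>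
     ring_flow (fst (snd \<omega>) ` {..<n}) (bdy_out (snd (snd \<omega>) ` {..<n'})) (fst \<omega>) = j)"
    for \<omega> :: "('a \<times> 'a) \<times> (nat \<Rightarrow> 'a) \<times> (nat \<Rightarrow> 'a)"
  have in_j: "Measurable.pred \<Omega> (\<lambda>\<omega>. h \<omega> = j)" if "h \<in> \<Omega> \<rightarrow>\<^sub>M count_space UNIV" for h
    using that by simp
  have "Measurable.pred \<Omega> Q"
    unfolding Q_def
    by (intro pred_intros_logic(2-6) pred_in_borel[OF m(1) E_borel] V.pred_ring m
        V.pred_integral_out in_j V.measurable_ring_flow W.measurable_bdy_out
        W.pred_parent[of "\<lambda>i \<omega>. fst (snd \<omega>) i" n])
  then have "{\<omega> \<in> D. Q \<omega>} \<in> sets \<Omega>" by (simp add: pred_def sp)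
  then have "{\<omega> \<in> D. Q \<omega>} \<in> sets ?B" using D by (simp add: \<Omega>_def sets_restrict_space_iff)
  moreover have "parent_witness j n n' = {\<omega> \<in> D. Q \<omega>}"
    by (auto simp: parent_witness_def D_def Q_def)
  ultimately show ?thesis by simp
qed

lemma \<psi>_borel: "(\<lambda>e. real_of_int (\<psi> e)) \<in> borel_measurable (restrict_space borel E)"
proof -
  have "{e \<in> E. \<psi> e = j} \<in> sets borel" for j
  proof (rule borel_partition_projections[where A = "\<lambda>j. {e \<in> E. \<psi> e = j}", OF _ \<psi>_projection])
    show "lone_witness j (fst (prod_decode i)) \<union>
       parent_witness j (fst (prod_decode i)) (snd (prod_decode i)) \<in> sets borel" for j i
      by (intro sets.Un lone_witness_borel parent_witness_borel)
    have "(\<Union>j. {e \<in> E. \<psi> e = j}) = E" by blast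
    then show "(\<Union>j. {e \<in> E. \<psi> e = j}) \<in> sets borel" using E_borel by simp
  qed blast
  then have "\<psi> \<in> restrict_space borel E \<rightarrow>\<^sub>M count_space UNIV"
    using E_borel
    by (auto simp: measurable_count_space_eq2_countable space_restrict_space sets_restrict_space_iff
        vimage_def Int_def conj_commute)
  then show ?thesis by simp
qed

end

theorem theorem1p5:
  fixes E :: "('a::polish_space \<times> 'a) set"
    and f :: "'a \<Rightarrow> int"
    and \<phi> :: "'a \<times> 'a \<Rightarrow> real"
  assumes "borel_graph E"
    and "locally_finite_graph E"
    and "f \<in> borel_measurable borel"
    and "\<exists>B. \<forall>x. \<bar>f x\<bar> \<le> B"
    and "borel_flow E f \<phi>"
    and "\<exists>T. borel_connected_toast E T"
  shows "\<exists>\<psi>. borel_flow E f \<psi> \<and> (\<forall>e\<in>E. \<psi> e \<in> \<int>) \<and> (\<forall>e\<in>E. \<bar>\<phi> e - \<psi> e\<bar> < 3)"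
proof -
  obtain T where T: "borel_connected_toast E T" using assms(6) by blast
  have E: "sym E" "E \<in> sets borel" using assms(1) by (auto simp: borel_graph_def)
  have flow: "is_flow E f \<phi>" and \<phi>: "\<phi> \<in> borel_measurable (restrict_space borel E)"
    using assms(5) by (auto simp: borel_flow_def)
  obtain F :: "nat \<Rightarrow> 'a \<times> 'a \<Rightarrow> int" where F: "\<And>m. F m \<in> borel \<rightarrow>\<^sub>M count_space UNIV"
    "\<And>S g. finite S \<Longrightarrow> \<exists>m. \<forall>x\<in>S. F m x = g x"
    using interpolating_borel_functions by blast
  obtain G :: "nat \<Rightarrow> 'a \<times> 'a \<times> 'a \<Rightarrow> int" where G: "\<And>m. G m \<in> borel \<rightarrow>\<^sub>M count_space UNIV"
    "\<And>S g. finite S \<Longrightarrow> \<exists>m. \<forall>x\<in>S. G m x = g x"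
    using interpolating_borel_functions by blast
  \<comment> \<open>The hypotheses say nothing about \<phi> off \<open>E\<close>; extending it by 0
    gives a globally antisymmetric Borel function.\<close>
  define \<phi>' where "\<phi>' e = (if e \<in> E then \<phi> e else 0)" for e
  interpret borel_toast_flow E T f \<phi>' F G
  proof
    show "sym E" "locally_finite_graph E" "E \<in> sets borel" by fact+
    show "connected_toast E T" "T \<in> sets finite_sets_borel"
      using T by (auto simp: borel_connected_toast_def)
    show "\<phi>' (x, y) = - \<phi>' (y, x)" for x y
      using flow E(1) by (auto simp: \<phi>'_def is_flow_def dest: symD)
    show "\<phi>' e = 0" if "e \<notin> E" for e using that by (simp add: \<phi>'_def)
    show "(\<Sum>y\<in>E `` {x}. \<phi>' (x, y)) = of_int (f x)" for x
      using flow by (simp add: \<phi>'_def is_flow_def)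
    show "\<phi>' \<in> borel_measurable borel"
      unfolding \<phi>'_def using \<phi> E(2)
      by (subst measurable_If_restrict_space_iff) auto
    have "f \<in> borel \<rightarrow>\<^sub>M count_space UNIV"
      using assms(3) by (simp add: measurable_cong_sets[OF refl sets_borel_eq_count_space])
    then show "(\<lambda>x. real_of_int (f x)) \<in> borel_measurable borel" by simp
  qed (fact F G)+
  have "borel_flow E f (\<lambda>e. of_int (\<psi> e))"
    unfolding borel_flow_def is_flow_def using \<psi>_borel \<psi>_flow \<psi>_edge(1) by auto
  moreover have "\<bar>\<phi> e - of_int (\<psi> e)\<bar> < 3" if "e \<in> E" for e
    using \<psi>_edge(2)[of "fst e" "snd e"] that by (simp add: \<phi>'_def)
  ultimately show ?thesis by (intro exI[of _ "\<lambda>e. of_int (\<psi> e)"]) auto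
qed

end
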